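(* Let $n\geq2$, $\ell\in\{1,\ldots,n-1\}$ and $a>0$. Let $X_1,\ldots,X_n$ be independent and identically distributed real-valued random variables with probability density function $f$ and distribution function $F(x)=\int_{-\infty}^xf(y)\,\mathrm{d}y$, $x\in\mathbb{R}$. Let $X_{1:n}<\cdots<X_{n:n}$ be the order statistics of $X_1,\ldots,X_n$ and let $$K_n(a,\ell)=|\{i\in\{1,\ldots,n\}:X_{n-\ell+1:n}-a<X_i\leq X_{n-\ell+1:n}\}|.$$ Let $Z\sim\mathrm{NB}(\ell,1-\beta)$ with $\beta=\frac{\mathbb{E}[K_n(a,\ell)]-1}{\mathbb{E}[K_n(a,\ell)]+\ell-1}$. Then $$d_{\mathrm{TV}}(K_n(a,\ell)-1,Z)\leq\frac{1-(1-\beta)^\ell}{\beta\ell}\,\mathbb{E}[K_n(a,\ell)-1]\left(\beta+(1-\beta)\left[(n-\ell-1)\frac{M_2}{M_1}-(n-\ell-2)M_1\right]\right),$$ where, for $j=1,2$, $$M_j=n\binom{n-1}{\ell-1}\int_{-\infty}^\infty(1-F(x))^{\ell-1}F(x)^{n-\ell}\left(1-\frac{F(x-a)}{F(x)}\right)^jf(x)\,\mathrm{d}x.$$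
   Context: For $\ell>0$ and $\beta\in(0,1)$, $Z\sim\mathrm{NB}(\ell,1-\beta)$ means $\mathbb{P}(Z=k)=\frac{\Gamma(\ell+k)}{\Gamma(\ell)k!}(1-\beta)^\ell\beta^k$ for $k=0,1,\ldots$, where $\Gamma$ is the gamma function. For random variables $K,L$ supported on $\mathbb{Z}^+=\{0,1,2,\ldots\}$, the total variation distance is $d_{\mathrm{TV}}(K,L)=\sup_{E\subseteq\mathbb{Z}^+}|\mathbb{P}(K\in E)-\mathbb{P}(L\in E)|=\frac12\sum_{j\in\mathbb{Z}^+}|\mathbb{P}(K=j)-\mathbb{P}(L=j)|$. The integrand defining $M_j$ is interpreted as $0$ at points where $F(x)=0$ (such points have probability zero under $f$). The order statistics are almost surely distinct since the $X_i$ have a density. *)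

theory Defs
  imports "HOL-Probability.Probability"
begin

text \<open>The sample \<open>X\<^sub>1, \<dots>, X\<^sub>n\<close> is \<open>X 1, \<dots>, X n\<close>; ranks are counted from \<open>1\<close>, so
  \<open>order_stat X n k \<omega>\<close> is the \<open>k\<close>-th smallest value \<open>X\<^bsub>k:n\<^esub>(\<omega>)\<close> for \<open>1 \<le> k \<le> n\<close>.\<close>

definition order_stat :: "(nat \<Rightarrow> 'a \<Rightarrow> real) \<Rightarrow> nat \<Rightarrow> nat \<Rightarrow> 'a \<Rightarrow> real" where
  "order_stat X n k \<omega> = sort (map (\<lambda>i. X i \<omega>) [1..<Suc n]) ! (k - 1)"

text \<open>For \<open>1 \<le> l \<le> n\<close> the order statistic is itself one of the sample values, so with \<open>a > 0\<close>
  the count is at least \<open>1\<close> and subtracting \<open>1\<close> from it in \<^typ>\<open>nat\<close> does not truncate.\<close>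

definition near_order_stat_count ::
    "(nat \<Rightarrow> 'a \<Rightarrow> real) \<Rightarrow> nat \<Rightarrow> real \<Rightarrow> nat \<Rightarrow> 'a \<Rightarrow> nat" where
  "near_order_stat_count X n a l \<omega> =
     card {i \<in> {1..n}. order_stat X n (n - l + 1) \<omega> - a < X i \<omega> \<and>
                       X i \<omega> \<le> order_stat X n (n - l + 1) \<omega>}"

definition density_cdf :: "(real \<Rightarrow> real) \<Rightarrow> real \<Rightarrow> real" where
  "density_cdf f x = (LBINT y:{..x}. f y)"

definition M_int :: "(real \<Rightarrow> real) \<Rightarrow> nat \<Rightarrow> nat \<Rightarrow> real \<Rightarrow> nat \<Rightarrow> real" where
  "M_int f n l a j =
     real n * real ((n - 1) choose (l - 1)) *
     (LBINT x. (if density_cdf f x = 0 then 0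
                else (1 - density_cdf f x) ^ (l - 1) * density_cdf f x ^ (n - l) *
                     (1 - density_cdf f (x - a) / density_cdf f x) ^ j * f x))"

text \<open>\<open>Z \<sim> NB(r, p)\<close> for real \<open>r > 0\<close>; \<open>p\<close> is the success probability, so that
  \<open>NB(r, 1 - \<beta>)\<close> has point masses
  \<open>\<Gamma>(r + k) / (\<Gamma>(r) k!) (1 - \<beta>)\<^sup>r \<beta>\<^sup>k\<close>.\<close>

definition neg_binomial_rv :: "'b measure \<Rightarrow> ('b \<Rightarrow> nat) \<Rightarrow> real \<Rightarrow> real \<Rightarrow> bool" where
  "neg_binomial_rv N Z r p \<longleftrightarrow>
     Z \<in> measurable N (count_space UNIV) \<and>
     (\<forall>k. measure N {\<omega> \<in> space N. Z \<omega> = k} =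
            Gamma (r + real k) / (Gamma r * fact k) * p powr r * (1 - p) ^ k)"

text \<open>The two random variables may live on different probability spaces.\<close>

definition tv_dist :: "'a measure \<Rightarrow> ('a \<Rightarrow> nat) \<Rightarrow> 'b measure \<Rightarrow> ('b \<Rightarrow> nat) \<Rightarrow> real" where
  "tv_dist M K N L =
     (SUP E. \<bar>measure M {\<omega> \<in> space M. K \<omega> \<in> E} - measure N {\<omega> \<in> space N. L \<omega> \<in> E}\<bar>)"

end

theory Submission
  imports Defs
begin

text \<open>
  Write \<open>W = K - 1\<close>, \<open>N = n - l\<close>, \<open>\<mu> = E W\<close> and let \<open>F\<close> be the distribution function of the
  sample. Conditionally on the value \<open>x\<close> of the order statistic, the \<open>N\<close> smaller sample points
  are independent, and each lies in the window \<open>(x - a, x]\<close> with probability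
  \<open>p(x) = 1 - F(x - a) / F(x)\<close>. So \<open>W\<close> is a binomial variable \<open>Bin(N, p)\<close> mixed over a random
  \<open>p\<close> with moments \<open>E p\<^sup>j = M\<^sub>j\<close>
  (\<open>near_order_stat_count_mixed_binomial\<close>, \<open>M_int_eq_integral\<close>); in particular \<open>\<mu> = N M\<^sub>1\<close>, and
  \<open>\<beta> = \<mu> / (\<mu> + l)\<close> is chosen so that \<open>Z\<close> has the same mean as \<open>W\<close>.

  The distance is estimated by Stein's method. For a set \<open>E\<close> let \<open>g\<close> solve
  \<open>\<beta> (l + k) g(k + 1) - k g(k) = 1\<^sub>E(k) - P(Z \<in> E)\<close>. Then \<open>\<bar>g(k + 1) - g(k)\<bar> \<le> c\<close> for \<open>k \<ge> 1\<close>, with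
  \<open>c = (1 - (1 - \<beta>)\<^sup>l) / (\<beta> l)\<close> (\<open>neg_binomial_stein_solution\<close>). Let \<open>W*\<close> be the size-biased
  version of \<open>W\<close>, that is, \<open>E (W h(W)) = \<mu> E h(W*)\<close>. Taking expectations in the
  Stein equation at \<open>W\<close> and using \<open>\<beta> l = (1 - \<beta>) \<mu>\<close> gives

    \<open>P(W \<in> E) - P(Z \<in> E) = \<mu> ((1 - \<beta>) (E g(W + 1) - E g(W*)) + \<beta> E (g(W* + 1) - g(W*)))\<close>.

  The last expectation is at most \<open>c\<close> in absolute value. For the first difference put
  \<open>\<psi>(q) = E g(1 + Bin(N - 1, q))\<close>. Size biasing a binomial law removes one trial, so
  \<open>E g(W*) = E (p \<psi>(p)) / M\<^sub>1\<close>, while \<open>E g(W + 1)\<close> differs from \<open>E \<psi>(p)\<close> by at most \<open>c M\<^sub>1\<close>, the effect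
  of one further trial. What remains is the covariance \<open>E (\<psi>(p) (M\<^sub>1 - p)) / M\<^sub>1\<close>; as \<open>\<psi>\<close> is Lipschitz
  with constant \<open>(N - 1) c\<close>, it is at most \<open>(N - 1) c (M\<^sub>2 - M\<^sub>1\<^sup>2) / M\<^sub>1\<close>. The sum of the two
  bounds is \<open>c ((N - 1) M\<^sub>2 / M\<^sub>1 - (N - 2) M\<^sub>1)\<close>, as claimed
  (\<open>mixed_binomial_stein_bound\<close>).
\<close>

section \<open>Mixed binomial laws\<close>

text \<open>\<open>binom_mean m p h\<close> is \<open>E h(B)\<close> for \<open>B \<sim> Bin(m, p)\<close>. Written as a finite sum it is
  visibly a polynomial in \<open>p\<close>, hence measurable when \<open>p\<close> itself is random.\<close>

definition binom_mean :: "nat \<Rightarrow> real \<Rightarrow> (nat \<Rightarrow> real) \<Rightarrow> real" where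
  "binom_mean m p h = (\<Sum>k\<le>m. real (m choose k) * p ^ k * (1 - p) ^ (m - k) * h k)"

lemma binom_mean_0 [simp]: "binom_mean 0 p h = h 0"
  by (simp add: binom_mean_def)

lemma binom_mean_Suc:
  "binom_mean (Suc m) p h =
     p * binom_mean m p (\<lambda>k. h (Suc k)) + (1 - p) * binom_mean m p h"
proof -
  have shift: "(\<Sum>k\<le>m. real (m choose Suc k) * p ^ Suc k * (1 - p) ^ (m - k) * h (Suc k))
      + (1 - p) ^ Suc m * h 0 = (1 - p) * binom_mean m p h"
  proof -
    have "(1 - p) * binom_mean m p h =
        (\<Sum>k\<le>m. real (m choose k) * p ^ k * (1 - p) ^ (Suc m - k) * h k)"
      unfolding binom_mean_def sum_distrib_left
      by (intro sum.cong) (auto simp: Suc_diff_le)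
    also have "\<dots> = (\<Sum>k\<le>Suc m. real (m choose k) * p ^ k * (1 - p) ^ (Suc m - k) * h k)"
      by simp
    also have "\<dots> = (1 - p) ^ Suc m * h 0 +
        (\<Sum>k\<le>m. real (m choose Suc k) * p ^ Suc k * (1 - p) ^ (m - k) * h (Suc k))"
      by (subst sum.atMost_Suc_shift) simp
    finally show ?thesis by simp
  qed
  have "binom_mean (Suc m) p h = (1 - p) ^ Suc m * h 0 +
      (\<Sum>k\<le>m. real (Suc m choose Suc k) * p ^ Suc k * (1 - p) ^ (m - k) * h (Suc k))"
    unfolding binom_mean_def by (subst sum.atMost_Suc_shift) simp
  also have "(\<Sum>k\<le>m. real (Suc m choose Suc k) * p ^ Suc k * (1 - p) ^ (m - k) * h (Suc k)) =
      p * binom_mean m p (\<lambda>k. h (Suc k)) +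
      (\<Sum>k\<le>m. real (m choose Suc k) * p ^ Suc k * (1 - p) ^ (m - k) * h (Suc k))"
    unfolding binom_mean_def sum_distrib_left sum.distrib[symmetric]
    by (intro sum.cong) (auto simp: algebra_simps)
  finally show ?thesis using shift by simp
qed

lemma binom_mean_add: "binom_mean m p (\<lambda>k. g k + h k) = binom_mean m p g + binom_mean m p h"
  by (simp add: binom_mean_def algebra_simps sum.distrib)

lemma binom_mean_diff: "binom_mean m p (\<lambda>k. g k - h k) = binom_mean m p g - binom_mean m p h"
  by (simp add: binom_mean_def algebra_simps sum_subtractf)

lemma binom_mean_cmult: "binom_mean m p (\<lambda>k. c * h k) = c * binom_mean m p h"
  by (simp add: binom_mean_def sum_distrib_left mult_ac)

lemma binom_mean_const [simp]: "binom_mean m p (\<lambda>k. c) = c"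
  by (induction m) (simp_all add: binom_mean_Suc algebra_simps)

text \<open>The size-biased version of \<open>Bin(m + 1, p)\<close> is \<open>1 + Bin(m, p)\<close>.\<close>

lemma binom_mean_size_bias:
  "binom_mean (Suc m) p (\<lambda>k. real k * h k) = real (Suc m) * p * binom_mean m p (\<lambda>k. h (Suc k))"
proof -
  have "binom_mean (Suc m) p (\<lambda>k. real k * h k) =
      (\<Sum>k\<le>m. real (Suc k * (Suc m choose Suc k)) * p ^ Suc k * (1 - p) ^ (m - k) * h (Suc k))"
    unfolding binom_mean_def of_nat_mult
    by (subst sum.atMost_Suc_shift) (simp del: binomial_Suc_Suc of_nat_Suc mult_Suc add: mult_ac)
  also have "\<dots> = real (Suc m) * p * binom_mean m p (\<lambda>k. h (Suc k))"
    unfolding binom_mean_def sum_distrib_left Suc_times_binomial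
    by (intro sum.cong) (auto simp: algebra_simps)
  finally show ?thesis .
qed

lemma abs_binom_mean_le:
  assumes "0 \<le> p" "p \<le> 1" "\<And>k. \<bar>h k\<bar> \<le> c"
  shows "\<bar>binom_mean m p h\<bar> \<le> c"
proof -
  have "\<bar>binom_mean m p h\<bar> \<le> binom_mean m p (\<lambda>k. \<bar>h k\<bar>)"
    unfolding binom_mean_def using assms
    by (intro order.trans[OF sum_abs] sum_mono) (simp add: abs_mult)
  also have "\<dots> \<le> binom_mean m p (\<lambda>k. c)"
    unfolding binom_mean_def using assms by (intro sum_mono mult_left_mono) auto
  finally show ?thesis by simp
qed

text \<open>Raising the success probability of one trial from \<open>q\<close> to \<open>p\<close> costs at most \<open>c \<bar>p - q\<bar>\<close>; there
  are \<open>m\<close> trials.\<close>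

lemma binom_mean_lipschitz:
  assumes p: "0 \<le> p" "p \<le> 1" and q: "0 \<le> q" "q \<le> 1"
    and "\<And>k. \<bar>h (Suc k) - h k\<bar> \<le> c"
  shows "\<bar>binom_mean m p h - binom_mean m q h\<bar> \<le> real m * c * \<bar>p - q\<bar>"
  using assms(5)
proof (induction m arbitrary: h)
  case (Suc m)
  let ?b = "\<lambda>p. binom_mean m p h" and ?b' = "\<lambda>p. binom_mean m p (\<lambda>k. h (Suc k))"
  have 1: "\<bar>?b p - ?b q\<bar> \<le> real m * c * \<bar>p - q\<bar>" and 2: "\<bar>?b' p - ?b' q\<bar> \<le> real m * c * \<bar>p - q\<bar>"
    using Suc by auto
  have 3: "\<bar>?b' q - ?b q\<bar> \<le> c"
    unfolding binom_mean_diff[symmetric] using Suc.prems q by (intro abs_binom_mean_le)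
  have "binom_mean (Suc m) p h - binom_mean (Suc m) q h =
      p * (?b' p - ?b' q) + (1 - p) * (?b p - ?b q) + (p - q) * (?b' q - ?b q)"
    by (simp add: binom_mean_Suc algebra_simps)
  also have "\<bar>\<dots>\<bar> \<le> \<bar>p * (?b' p - ?b' q)\<bar> + \<bar>(1 - p) * (?b p - ?b q)\<bar> + \<bar>(p - q) * (?b' q - ?b q)\<bar>"
    by linarith
  also have "\<dots> \<le> p * (real m * c * \<bar>p - q\<bar>) + (1 - p) * (real m * c * \<bar>p - q\<bar>) + \<bar>p - q\<bar> * c"
    unfolding abs_mult using p 1 2 3 by (intro add_mono mult_mono) auto
  also have "\<dots> = real (Suc m) * c * \<bar>p - q\<bar>"
    by (simp add: algebra_simps)
  finally show ?case .
qed simp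

text \<open>The expectation of the negative binomial Stein operator under a mixed binomial law. The
  relation between \<open>\<beta>\<close> and \<open>r\<close> says that both laws have the same mean. Note that \<open>g 0\<close>
  enters the operator with coefficient \<open>0\<close>, so increments are only needed from \<open>1\<close> on.\<close>

lemma (in prob_space) mixed_binomial_stein_bound:
  fixes p :: "'a \<Rightarrow> real" and g :: "nat \<Rightarrow> real" and N :: nat and r \<beta> c :: real
  defines "M1 \<equiv> expectation p" and "M2 \<equiv> expectation (\<lambda>x. (p x)\<^sup>2)"
  assumes p [measurable]: "p \<in> borel_measurable M" and p01: "\<And>x. 0 \<le> p x" "\<And>x. p x \<le> 1"
    and N: "N \<ge> 1" and M1: "M1 > 0" and \<beta>: "0 < \<beta>" "\<beta> < 1"
    and mean: "\<beta> * r = (1 - \<beta>) * (real N * M1)"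
    and g: "\<And>k. k \<ge> 1 \<Longrightarrow> \<bar>g (Suc k) - g k\<bar> \<le> c"
  shows "\<bar>expectation (\<lambda>x. binom_mean N (p x) (\<lambda>k. \<beta> * (r + real k) * g (Suc k) - real k * g k))\<bar>
    \<le> c * (real N * M1) * (\<beta> + (1 - \<beta>) * ((real N - 1) * (M2 / M1) - (real N - 2) * M1))"
proof -
  obtain m where m: "N = Suc m" using N by (cases N) auto
  \<comment> \<open>Conditionally on \<open>p = q\<close>, \<open>\<psi> q\<close> is the mean of \<open>g\<close> under the size-biased count and \<open>\<delta> q\<close>
      the mean increment of \<open>g\<close> there.\<close>
  define h where "h k = g (Suc k)" for k
  define \<psi> where "\<psi> q = binom_mean m q h" for q
  define \<delta> where "\<delta> q = binom_mean m q (\<lambda>k. h (Suc k) - h k)" for q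
  have h: "\<bar>h (Suc k) - h k\<bar> \<le> c" for k using g[of "Suc k"] by (simp add: h_def)
  have bint: "integrable M F" if "F \<in> borel_measurable M" "\<And>x. \<bar>F x\<bar> \<le> B" for F :: "'a \<Rightarrow> real" and B
    using that by (intro integrable_const_bound[where B=B]) auto
  have pbint: "integrable M (\<lambda>x. p x * F x)"
    if [measurable]: "F \<in> borel_measurable M" and F: "\<And>x. \<bar>F x\<bar> \<le> B" for F :: "'a \<Rightarrow> real" and B
  proof (rule bint)
    show "\<bar>p x * F x\<bar> \<le> 1 * B" for x
      unfolding abs_mult using p01[of x] F[of x] by (intro mult_mono) auto
  qed measurable
  have m\<psi> [measurable]: "(\<lambda>x. \<psi> (p x)) \<in> borel_measurable M" and
       m\<delta> [measurable]: "(\<lambda>x. \<delta> (p x)) \<in> borel_measurable M"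
    unfolding \<psi>_def \<delta>_def binom_mean_def by measurable
  have b\<delta>: "\<bar>\<delta> (p x)\<bar> \<le> c" for x
    unfolding \<delta>_def using p01 h by (intro abs_binom_mean_le)
  have b\<psi>: "\<bar>\<psi> (p x)\<bar> \<le> (\<Sum>j\<le>m. \<bar>h j\<bar>)" for x
  proof -
    have "\<psi> (p x) = binom_mean m (p x) (\<lambda>k. if k \<le> m then h k else 0)"
      unfolding \<psi>_def binom_mean_def by (intro sum.cong) auto
    also have "\<bar>\<dots>\<bar> \<le> (\<Sum>j\<le>m. \<bar>h j\<bar>)"
      by (rule abs_binom_mean_le)
         (use p01 in \<open>auto intro: member_le_sum sum_nonneg\<close>)
    finally show ?thesis .
  qed
  have ip: "integrable M p" and ip2: "integrable M (\<lambda>x. (p x)\<^sup>2)"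
    using p01 by (intro bint[of _ 1]; simp add: power_le_one)+
  have ip\<delta>: "integrable M (\<lambda>x. p x * \<delta> (p x))"
    using b\<delta> by (intro pbint) auto
  have i\<psi>: "integrable M (\<lambda>x. \<psi> (p x))"
    using b\<psi> by (intro bint) auto
  have ip\<psi>: "integrable M (\<lambda>x. p x * \<psi> (p x))"
    using b\<psi> by (intro pbint) auto
  have i\<psi>M: "integrable M (\<lambda>x. (\<psi> (p x) - \<psi> M1) * (M1 - p x))"
    using ip i\<psi> ip\<psi> by (simp add: algebra_simps)
  have iv: "integrable M (\<lambda>x. (M1 - p x)\<^sup>2)"
    using ip ip2 by (simp add: power2_eq_square algebra_simps)
  have pm: "prob (space M) = 1" by (rule prob_space)
  have M1le: "M1 \<le> 1"
    unfolding M1_def using integral_mono[OF ip, of "\<lambda>_. 1"] p01 pm by simp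

  \<comment> \<open>Conditioning on one trial in the first term and size biasing in the two others.\<close>
  have eq: "binom_mean N q (\<lambda>k. \<beta> * (r + real k) * g (Suc k) - real k * g k) =
      real N * ((1 - \<beta>) * M1 * (\<psi> q + q * \<delta> q) + \<beta> * (q * (\<psi> q + \<delta> q)) - q * \<psi> q)" for q
  proof -
    have "(\<lambda>k. \<beta> * (r + real k) * g (Suc k) - real k * g k) =
        (\<lambda>k. (\<beta> * r * h k + \<beta> * (real k * h k)) - real k * g k)"
      by (auto simp: h_def algebra_simps)
    hence "binom_mean N q (\<lambda>k. \<beta> * (r + real k) * g (Suc k) - real k * g k) =
        \<beta> * r * binom_mean N q h + \<beta> * binom_mean N q (\<lambda>k. real k * h k)
          - binom_mean N q (\<lambda>k. real k * g k)"
      by (simp only: binom_mean_add binom_mean_diff binom_mean_cmult)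
    also have "binom_mean N q h = \<psi> q + q * \<delta> q"
      unfolding m binom_mean_Suc \<psi>_def \<delta>_def binom_mean_diff by (simp add: algebra_simps)
    also have "binom_mean N q (\<lambda>k. real k * h k) = real N * q * (\<psi> q + \<delta> q)"
      unfolding m binom_mean_size_bias \<psi>_def \<delta>_def binom_mean_diff by simp
    also have "binom_mean N q (\<lambda>k. real k * g k) = real N * q * \<psi> q"
      unfolding m binom_mean_size_bias \<psi>_def h_def ..
    finally show ?thesis unfolding mean by (simp add: algebra_simps)
  qed
  have "expectation (\<lambda>x. binom_mean N (p x) (\<lambda>k. \<beta> * (r + real k) * g (Suc k) - real k * g k)) =
      real N * ((1 - \<beta>) * M1 * (expectation (\<lambda>x. \<psi> (p x)) + expectation (\<lambda>x. p x * \<delta> (p x)))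
       + \<beta> * (expectation (\<lambda>x. p x * \<psi> (p x)) + expectation (\<lambda>x. p x * \<delta> (p x)))
       - expectation (\<lambda>x. p x * \<psi> (p x)))"
    unfolding eq using ip\<delta> i\<psi> ip\<psi> by (simp add: distrib_left)
  also have "\<dots> = real N * ((1 - \<beta>) * (M1 * expectation (\<lambda>x. p x * \<delta> (p x))
        + expectation (\<lambda>x. (\<psi> (p x) - \<psi> M1) * (M1 - p x)))
        + \<beta> * expectation (\<lambda>x. p x * \<delta> (p x)))"
  proof -
    \<comment> \<open>\<open>M1 - p\<close> is centred, so the constant \<open>\<psi> M1\<close> may be subtracted freely. This turns the
        distance between the count and its size-biased version into a covariance.\<close>
    have "expectation (\<lambda>x. (\<psi> (p x) - \<psi> M1) * (M1 - p x)) =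
       expectation (\<lambda>x. M1 * \<psi> (p x) - p x * \<psi> (p x) - \<psi> M1 * M1 + \<psi> M1 * p x)"
      by (intro Bochner_Integration.integral_cong) (auto simp: algebra_simps)
    also have "\<dots> = M1 * expectation (\<lambda>x. \<psi> (p x)) - expectation (\<lambda>x. p x * \<psi> (p x))"
      using ip i\<psi> ip\<psi> pm by (simp add: M1_def)
    finally have V: "expectation (\<lambda>x. (\<psi> (p x) - \<psi> M1) * (M1 - p x)) =
       M1 * expectation (\<lambda>x. \<psi> (p x)) - expectation (\<lambda>x. p x * \<psi> (p x))" .
    show ?thesis unfolding V by (simp add: algebra_simps)
  qed
  finally have *: "expectation (\<lambda>x. binom_mean N (p x)
        (\<lambda>k. \<beta> * (r + real k) * g (Suc k) - real k * g k)) = \<dots>" .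
  have A: "\<bar>expectation (\<lambda>x. p x * \<delta> (p x))\<bar> \<le> c * M1"
  proof -
    have "\<bar>expectation (\<lambda>x. p x * \<delta> (p x))\<bar> \<le> expectation (\<lambda>x. \<bar>p x * \<delta> (p x)\<bar>)"
      by (rule integral_abs_bound)
    also have "\<dots> \<le> expectation (\<lambda>x. c * p x)"
    proof (intro integral_mono)
      show "\<bar>p x * \<delta> (p x)\<bar> \<le> c * p x" for x
        unfolding abs_mult using p01[of x] mult_left_mono[OF b\<delta>[of x], of "p x"] by (simp add: mult.commute)
    qed (use ip\<delta> ip in auto)
    finally show ?thesis by (simp add: M1_def)
  qed
  \<comment> \<open>As \<open>\<psi>\<close> is Lipschitz, the covariance is controlled by the variance \<open>M2 - M1\<^sup>2\<close> of \<open>p\<close>.\<close>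
  have B: "\<bar>expectation (\<lambda>x. (\<psi> (p x) - \<psi> M1) * (M1 - p x))\<bar> \<le> real m * c * (M2 - M1\<^sup>2)"
  proof -
    have "\<bar>expectation (\<lambda>x. (\<psi> (p x) - \<psi> M1) * (M1 - p x))\<bar>
        \<le> expectation (\<lambda>x. \<bar>(\<psi> (p x) - \<psi> M1) * (M1 - p x)\<bar>)"
      by (rule integral_abs_bound)
    also have "\<dots> \<le> expectation (\<lambda>x. real m * c * (M1 - p x)\<^sup>2)"
    proof (intro integral_mono)
      fix x
      have "\<bar>\<psi> (p x) - \<psi> M1\<bar> \<le> real m * c * \<bar>p x - M1\<bar>"
        unfolding \<psi>_def using p01 M1 M1le h by (intro binom_mean_lipschitz) auto
      hence "\<bar>\<psi> (p x) - \<psi> M1\<bar> * \<bar>M1 - p x\<bar> \<le> real m * c * \<bar>p x - M1\<bar> * \<bar>M1 - p x\<bar>"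
        by (rule mult_right_mono) simp
      also have "\<dots> = real m * c * (M1 - p x)\<^sup>2"
        by (simp add: power2_eq_square abs_minus_commute[of "p x"])
      finally show "\<bar>(\<psi> (p x) - \<psi> M1) * (M1 - p x)\<bar> \<le> real m * c * (M1 - p x)\<^sup>2"
        by (simp add: abs_mult)
    qed (use i\<psi>M iv in auto)
    also have "expectation (\<lambda>x. real m * c * (M1 - p x)\<^sup>2) = real m * c * expectation (\<lambda>x. (M1 - p x)\<^sup>2)"
      by simp
    also have "expectation (\<lambda>x. (M1 - p x)\<^sup>2) = expectation (\<lambda>x. M1\<^sup>2 - 2 * M1 * p x + (p x)\<^sup>2)"
      by (intro Bochner_Integration.integral_cong) (auto simp: power2_eq_square algebra_simps)
    also have "\<dots> = M2 - M1\<^sup>2"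
      using ip ip2 pm by (simp add: M1_def M2_def power2_eq_square)
    finally show ?thesis .
  qed
  let ?P = "expectation (\<lambda>x. p x * \<delta> (p x))" and ?V = "expectation (\<lambda>x. (\<psi> (p x) - \<psi> M1) * (M1 - p x))"
  have "\<bar>real N * ((1 - \<beta>) * (M1 * ?P + ?V) + \<beta> * ?P)\<bar>
      \<le> real N * ((1 - \<beta>) * (M1 * \<bar>?P\<bar> + \<bar>?V\<bar>) + \<beta> * \<bar>?P\<bar>)"
  proof -
    have "\<bar>(1 - \<beta>) * (M1 * ?P + ?V) + \<beta> * ?P\<bar> \<le> \<bar>(1 - \<beta>) * (M1 * ?P + ?V)\<bar> + \<bar>\<beta> * ?P\<bar>"
      by (rule abs_triangle_ineq)
    also have "\<dots> = (1 - \<beta>) * \<bar>M1 * ?P + ?V\<bar> + \<beta> * \<bar>?P\<bar>"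
      using \<beta> by (simp add: abs_mult)
    also have "\<dots> \<le> (1 - \<beta>) * (\<bar>M1 * ?P\<bar> + \<bar>?V\<bar>) + \<beta> * \<bar>?P\<bar>"
      using \<beta> by (intro add_mono mult_left_mono abs_triangle_ineq) auto
    finally show ?thesis using M1 by (simp add: abs_mult mult_left_mono)
  qed
  also have "\<dots> \<le> real N * ((1 - \<beta>) * (M1 * (c * M1) + real m * c * (M2 - M1\<^sup>2)) + \<beta> * (c * M1))"
    using A B \<beta> M1 by (intro mult_left_mono add_mono) auto
  also have "\<dots> = c * (real N * M1) * (\<beta> + (1 - \<beta>) * ((real N - 1) * (M2 / M1) - (real N - 2) * M1))"
    using M1 by (simp add: m field_simps power2_eq_square)
  finally show ?thesis unfolding * .
qed

section \<open>Stein's equation for the negative binomial law\<close>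

text \<open>The Stein equation of \<open>NB(r, 1 - \<beta>)\<close> for the test function \<open>1\<^sub>E\<close>, with the uniform bound on the
  increments of its solution. Beyond positivity and total mass \<open>1\<close>, only the recursion of the
  point masses is needed, which is the detailed balance equation of the birth-death chain with birth rates
  \<open>\<beta> (r + k)\<close> and death rates \<open>k\<close>.\<close>

lemma neg_binomial_stein_solution:
  fixes \<pi> :: "nat \<Rightarrow> real" and r \<beta> :: real and E :: "nat set"
  assumes \<beta>: "0 < \<beta>" "\<beta> < 1" and r: "r > 0"
    and pos: "\<And>k. \<pi> k > 0" and sums1: "\<pi> sums 1"
    and rec: "\<And>k. real (Suc k) * \<pi> (Suc k) = \<beta> * (r + real k) * \<pi> k"
  obtains g :: "nat \<Rightarrow> real" where
    "\<And>k. \<beta> * (r + real k) * g (Suc k) - real k * g k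
       = indicator E k - (\<Sum>j. indicator E j * \<pi> j)"
    "\<And>k. k \<ge> 1 \<Longrightarrow> \<bar>g (Suc k) - g k\<bar> \<le> (1 - \<pi> 0) / (\<beta> * r)"
proof -
  have sm: "summable \<pi>" and tot: "suminf \<pi> = 1"
    using sums1 by (auto simp: sums_iff)
  have nn: "0 \<le> \<pi> k" for k using pos[of k] by simp
  \<comment> \<open>Finiteness of the mean: by the recursion, its partial sums \<open>S\<close> satisfy \<open>S \<le> \<beta> r + \<beta> S\<close>.\<close>
  have smk: "summable (\<lambda>j. real j * \<pi> j)"
  proof (rule bounded_imp_summable)
    fix m
    have *: "(\<Sum>j\<le>m. \<pi> j) \<le> 1"
      using sum_le_suminf[OF sm, of "{..m}"] nn tot by auto
    have "(\<Sum>j\<le>m. real j * \<pi> j) \<le> (\<Sum>j\<le>Suc m. real j * \<pi> j)"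
      using nn[of "Suc m"] by simp
    also have "\<dots> = (\<Sum>j\<le>m. \<beta> * (r + real j) * \<pi> j)"
      by (subst sum.atMost_Suc_shift) (simp only: rec of_nat_0 mult_zero_left add_0)
    also have "\<dots> = \<beta> * r * (\<Sum>j\<le>m. \<pi> j) + \<beta> * (\<Sum>j\<le>m. real j * \<pi> j)"
      by (simp add: sum_distrib_left sum.distrib algebra_simps)
    also have "\<dots> \<le> \<beta> * r * 1 + \<beta> * (\<Sum>j\<le>m. real j * \<pi> j)"
      using * \<beta> r by (intro add_mono mult_left_mono) auto
    finally show "(\<Sum>j\<le>m. real j * \<pi> j) \<le> \<beta> * r / (1 - \<beta>)"
      using \<beta> by (simp add: field_simps)
  qed (use nn in auto)
  define \<alpha> where "\<alpha> k = \<beta> * (r + real k)" for k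
  have \<alpha>pos: "0 < \<alpha> k" for k using \<beta> r by (simp add: \<alpha>_def add_pos_nonneg)
  \<comment> \<open>The masses strictly below and strictly above \<open>k\<close>.\<close>
  define F where "F k = (\<Sum>j<k. \<pi> j)" for k
  define T where "T k = (\<Sum>j. \<pi> (j + Suc k))" for k
  have FT: "F k + \<pi> k + T k = 1" for k
    using suminf_split_initial_segment[OF sm, of "Suc k"] tot by (simp add: F_def T_def)
  have F0: "0 \<le> F k" for k unfolding F_def using nn by (auto intro: sum_nonneg)
  have smT: "summable (\<lambda>j. \<pi> (j + k))" for k using sm by (simp add: summable_iff_shift)
  have T0: "0 \<le> T k" for k unfolding T_def using nn smT[of "Suc k"] by (intro suminf_nonneg) auto
  \<comment> \<open>The next two estimates say that no point \<open>j \<noteq> k\<close> of \<open>E\<close> contributes positively to the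
      increment of the solution at \<open>k\<close>. Both follow from detailed balance and \<open>\<beta> < 1\<close>, by which the birth
      rates grow more slowly than the death rates.\<close>
  have F_le: "\<alpha> k * F k \<le> real k * (F k + \<pi> k)" for k
  proof -
    have "\<alpha> k * F k = (\<Sum>j<k. \<beta> * real (k - j) * \<pi> j) + (\<Sum>j<k. real (Suc j) * \<pi> (Suc j))"
      unfolding F_def sum_distrib_left sum.distrib[symmetric] rec
      by (intro sum.cong) (auto simp: \<alpha>_def of_nat_diff algebra_simps)
    also have "(\<Sum>j<k. real (Suc j) * \<pi> (Suc j)) = (\<Sum>j<Suc k. real j * \<pi> j)"
      by (subst sum.lessThan_Suc_shift) simp
    also have "(\<Sum>j<k. \<beta> * real (k - j) * \<pi> j) \<le> (\<Sum>j<k. real (k - j) * \<pi> j)"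
      using \<beta> nn by (intro sum_mono mult_right_mono) (auto simp: mult_left_le_one_le)
    also have "(\<Sum>j<k. real (k - j) * \<pi> j) = (\<Sum>j<Suc k. real (k - j) * \<pi> j)"
      by simp
    also have "\<dots> + (\<Sum>j<Suc k. real j * \<pi> j) = (\<Sum>j<Suc k. real k * \<pi> j)"
      unfolding sum.distrib[symmetric] by (intro sum.cong) (auto simp: of_nat_diff algebra_simps)
    also have "\<dots> = real k * (F k + \<pi> k)"
      by (simp add: F_def sum_distrib_left algebra_simps)
    finally show ?thesis by simp
  qed
  have T_le: "real k * T k \<le> \<alpha> k * (\<pi> k + T k)" for k
  proof -
    have s: "summable (\<lambda>j. real (j + k) * \<pi> (j + k))" for k
      using smk by (subst summable_iff_shift)
    have s': "summable (\<lambda>j. real j * \<pi> (j + k))" for k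
      using summable_diff[OF s[of k] summable_mult[OF smT[of k], of "real k"]]
      by (simp add: algebra_simps)
    have pT: "\<pi> k + T k = (\<Sum>j. \<pi> (j + k))"
      using suminf_split_head[OF smT[of k]] by (simp add: T_def)
    have D: "(\<Sum>j. real j * \<pi> (j + k)) = (\<Sum>j. real (Suc j) * \<pi> (j + Suc k))"
      using suminf_split_head[OF s'[of k]] by simp
    have sD: "summable (\<lambda>j. real (Suc j) * \<pi> (j + Suc k))"
      using summable_Suc_iff[of "\<lambda>j. real j * \<pi> (j + k)"] s'[of k] by simp
    have D0: "0 \<le> (\<Sum>j. real j * \<pi> (j + k))"
      using s' nn by (intro suminf_nonneg) auto
    have "real k * T k + (\<Sum>j. real (Suc j) * \<pi> (j + Suc k)) =
        (\<Sum>j. real k * \<pi> (j + Suc k) + real (Suc j) * \<pi> (j + Suc k))"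
      unfolding T_def using smT[of "Suc k"] sD
      by (simp add: suminf_add[symmetric] suminf_mult)
    also have "\<dots> = (\<Sum>j. real (Suc (j + k)) * \<pi> (Suc (j + k)))"
      by (simp add: algebra_simps)
    also have "\<dots> = (\<Sum>j. \<alpha> k * \<pi> (j + k) + \<beta> * (real j * \<pi> (j + k)))"
      unfolding rec by (simp add: algebra_simps \<alpha>_def)
    also have "\<dots> = \<alpha> k * (\<pi> k + T k) + \<beta> * (\<Sum>j. real j * \<pi> (j + k))"
      unfolding pT using smT[of k] s'[of k] by (simp add: suminf_add[symmetric] suminf_mult)
    also have "\<beta> * (\<Sum>j. real j * \<pi> (j + k)) \<le> 1 * (\<Sum>j. real j * \<pi> (j + k))"
      using \<beta> D0 by (intro mult_right_mono) auto
    finally show ?thesis using D by simp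
  qed
  \<comment> \<open>The contribution of the point \<open>k\<close> itself; here \<open>\<pi> 0\<close> is gained by moving the mass below
      \<open>k\<close> one step to the right.\<close>
  have diag: "T k / \<alpha> k + F k / real k \<le> (1 - \<pi> 0) / (\<beta> * r)" if k: "k \<ge> 1" for k
  proof -
    have "T k / \<alpha> k \<le> T k / (\<beta> * r)"
      using T0[of k] \<beta> r by (intro divide_left_mono) (auto simp: \<alpha>_def intro!: mult_pos_pos add_pos_nonneg)
    moreover have "F k / real k \<le> (F k + \<pi> k - \<pi> 0) / (\<beta> * r)"
    proof -
      have "\<beta> * r * F k = (\<Sum>j<k. \<beta> * r * \<pi> j)" by (simp add: F_def sum_distrib_left)
      also have "\<dots> \<le> (\<Sum>j<k. real k * \<pi> (Suc j))"
      proof (intro sum_mono)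
        fix j assume "j \<in> {..<k}"
        hence jk: "real (Suc j) \<le> real k" by simp
        have "\<pi> j * (real (Suc j) * r) \<le> \<pi> j * (real k * (r + real j))"
        proof (intro mult_left_mono)
          have "real (Suc j) * r \<le> real k * r" using jk r by (intro mult_right_mono) auto
          also have "\<dots> \<le> real k * (r + real j)" by (intro mult_left_mono) auto
          finally show "real (Suc j) * r \<le> real k * (r + real j)" .
        qed (use nn[of j] r in auto)
        hence "r * \<pi> j * real (Suc j) \<le> real k * ((r + real j) * \<pi> j)"
          by (simp only: mult_ac)
        hence "\<beta> * (r * \<pi> j * real (Suc j)) \<le> \<beta> * (real k * ((r + real j) * \<pi> j))"
          using \<beta> by (intro mult_left_mono) auto
        also have "\<dots> = real k * (real (Suc j) * \<pi> (Suc j))"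
          unfolding rec by (simp add: mult_ac)
        finally have "real (Suc j) * (\<beta> * r * \<pi> j) \<le> real (Suc j) * (real k * \<pi> (Suc j))"
          by (simp add: mult_ac)
        thus "\<beta> * r * \<pi> j \<le> real k * \<pi> (Suc j)"
          by (rule mult_left_le_imp_le) simp
      qed
      also have "\<dots> = real k * ((\<Sum>j<Suc k. \<pi> j) - \<pi> 0)"
        by (subst sum.lessThan_Suc_shift) (simp add: sum_distrib_left)
      also have "(\<Sum>j<Suc k. \<pi> j) = F k + \<pi> k" by (simp add: F_def)
      finally show ?thesis using k \<beta> r by (simp add: field_simps)
    qed
    ultimately have "T k / \<alpha> k + F k / real k \<le> T k / (\<beta> * r) + (F k + \<pi> k - \<pi> 0) / (\<beta> * r)"
      by (rule add_mono)
    also have "\<dots> = (F k + \<pi> k + T k - \<pi> 0) / (\<beta> * r)"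
      by (simp add: add_divide_distrib[symmetric] algebra_simps)
    finally show ?thesis unfolding FT .
  qed
  have smE: "summable (\<lambda>j. indicator E j * \<pi> j)" for E :: "nat set"
    by (rule summable_comparison_test'[OF sm, of 0]) (use nn in \<open>auto simp: indicator_def\<close>)
  \<comment> \<open>The mass of \<open>E\<close> below \<open>k\<close>, above \<open>k\<close>, at \<open>k\<close>, in total, and the resulting solution. Division by
      zero gives \<open>g E 0 = 0\<close>, which is harmless because that value is multiplied by \<open>0\<close>.\<close>
  define A where "A E k = (\<Sum>j<k. indicator E j * \<pi> j)" for E :: "nat set" and k
  define B where "B E k = (\<Sum>j. indicator E (j + Suc k) * \<pi> (j + Suc k))" for E :: "nat set" and k
  define e where "e E k = indicator E k * \<pi> k" for E :: "nat set" and k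
  define P where "P E = (\<Sum>j. indicator E j * \<pi> j)" for E :: "nat set"
  define g where "g E k = (A E k - P E * F k) / (real k * \<pi> k)" for E :: "nat set" and k
  have PAB: "P E = A E k + e E k + B E k" for E k
    using suminf_split_initial_segment[OF smE[of E], of "Suc k"]
    by (simp add: P_def A_def e_def B_def)
  have A0: "0 \<le> A E k" for E k unfolding A_def using nn by (auto intro: sum_nonneg)
  have B0: "0 \<le> B E k" for E k
    unfolding B_def using nn
    by (intro suminf_nonneg) (auto intro: smE[THEN summable_ignore_initial_segment, of _ "Suc k", simplified])
  have gS: "g E (Suc k) = (A E k + e E k - P E * (F k + \<pi> k)) / (\<alpha> k * \<pi> k)" for E k
    unfolding g_def rec by (simp add: A_def F_def e_def \<alpha>_def)
  have eqn: "\<alpha> k * g E (Suc k) - real k * g E k = indicator E k - P E" for E k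
  proof -
    have "real k * g E k = (A E k - P E * F k) / \<pi> k"
      by (cases "k = 0") (simp_all add: g_def A_def F_def)
    moreover have "\<alpha> k * g E (Suc k) = (A E k + e E k - P E * (F k + \<pi> k)) / \<pi> k"
      using \<alpha>pos[of k] by (simp add: gS)
    ultimately have "\<alpha> k * g E (Suc k) - real k * g E k = (e E k - P E * \<pi> k) / \<pi> k"
      by (simp add: diff_divide_distrib[symmetric] algebra_simps)
    also have "\<dots> = indicator E k - P E"
      unfolding e_def left_diff_distrib[symmetric] using pos[of k] by simp
    finally show ?thesis .
  qed
  have up: "g E (Suc k) - g E k \<le> (1 - \<pi> 0) / (\<beta> * r)" if k: "k \<ge> 1" for E k
  proof -
    let ?a = "A E k" and ?b = "B E k" and ?e = "e E k" and ?p = "\<pi> k"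
    have k0: "0 < real k" using k by simp
    have p: "?p = 1 - F k - T k" using FT[of k] by simp
    have "g E (Suc k) - g E k =
       ((?a + ?e) * T k - ?b * (F k + ?p)) / (\<alpha> k * ?p) - (?a * (?p + T k) - (?b + ?e) * F k) / (real k * ?p)"
    proof -
      have "?a + ?e - P E * (F k + ?p) = (?a + ?e) * T k - ?b * (F k + ?p)"
        unfolding PAB[of E k] p by (simp add: algebra_simps)
      moreover have "?a - P E * F k = ?a * (?p + T k) - (?b + ?e) * F k"
        unfolding PAB[of E k] p by (simp add: algebra_simps)
      ultimately show ?thesis unfolding gS by (simp add: g_def)
    qed
    also have "\<dots> = ?a * ((real k * T k - \<alpha> k * (?p + T k)) / (\<alpha> k * real k * ?p))
        + ?b * ((\<alpha> k * F k - real k * (F k + ?p)) / (\<alpha> k * real k * ?p))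
        + ?e / ?p * (T k / \<alpha> k + F k / real k)"
      using k0 \<alpha>pos[of k] pos[of k] by (simp add: field_simps)
    also have "\<dots> \<le> 0 + 0 + 1 * (T k / \<alpha> k + F k / real k)"
      using k0 \<alpha>pos[of k] pos[of k] A0 B0 F_le[of k] T_le[of k] F0[of k] T0[of k]
      by (intro add_mono mult_right_mono mult_nonneg_nonpos divide_nonpos_pos)
         (auto simp: e_def indicator_def)
    finally show ?thesis using diag[OF k] by simp
  qed
  \<comment> \<open>Passing to the complement changes the sign, so the upper bound yields the lower one.\<close>
  have neg: "g (- E) k = - g E k" for E k
  proof -
    have 1: "A (- E) k = F k - A E k"
      unfolding A_def F_def sum_subtractf[symmetric] by (intro sum.cong) (auto simp: indicator_def)
    have "P (- E) = (\<Sum>j. \<pi> j - indicator E j * \<pi> j)"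
      unfolding P_def by (intro suminf_cong) (auto simp: indicator_def)
    also have "\<dots> = 1 - P E"
      unfolding P_def using suminf_diff[OF sm smE[of E]] tot by simp
    finally have 2: "P (- E) = 1 - P E" .
    show ?thesis unfolding g_def 1 2 by (simp add: minus_divide_left algebra_simps)
  qed
  show ?thesis
  proof (rule that[of "g E"])
    fix k
    show "\<beta> * (r + real k) * g E (Suc k) - real k * g E k
       = indicator E k - (\<Sum>j. indicator E j * \<pi> j)"
      using eqn[of k E] by (simp add: \<alpha>_def P_def)
  next
    fix k :: nat assume k: "k \<ge> 1"
    show "\<bar>g E (Suc k) - g E k\<bar> \<le> (1 - \<pi> 0) / (\<beta> * r)"
      using up[OF k, of E] up[OF k, of "- E"] unfolding neg by linarith
  qed
qed

lemma neg_binomial_rv_pmf: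
  fixes r p :: real
  assumes N: "prob_space N" and Z: "neg_binomial_rv N Z r p" and r: "r > 0" and p: "0 < p" "p < 1"
  defines "\<pi> \<equiv> \<lambda>k. measure N {\<omega> \<in> space N. Z \<omega> = k}"
  shows "\<pi> k > 0" "real (Suc k) * \<pi> (Suc k) = (1 - p) * (r + real k) * \<pi> k" "\<pi> 0 = p powr r"
    and "(\<lambda>k. indicator E k * \<pi> k) sums measure N {\<omega> \<in> space N. Z \<omega> \<in> E}"
proof -
  interpret N: prob_space N by fact
  have [measurable]: "Z \<in> measurable N (count_space UNIV)"
    and \<pi>: "\<pi> k = Gamma (r + real k) / (Gamma r * fact k) * p powr r * (1 - p) ^ k" for k
    using Z by (auto simp: neg_binomial_rv_def \<pi>_def)
  have G: "Gamma (r + real k) > 0" for k using r by (intro Gamma_real_pos) auto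
  have G0: "Gamma r > 0" using r by (intro Gamma_real_pos) auto
  show "\<pi> k > 0" unfolding \<pi> using G G0 p by (intro mult_pos_pos divide_pos_pos) auto
  show "\<pi> 0 = p powr r" using G0 by (simp add: \<pi>)
  have "Gamma (r + real (Suc k)) = (r + real k) * Gamma (r + real k)"
    using Gamma_plus1[of "r + real k"] r by (auto simp: add_ac nonpos_Ints_def)
  thus "real (Suc k) * \<pi> (Suc k) = (1 - p) * (r + real k) * \<pi> k"
    unfolding \<pi> by (simp add: fact_Suc divide_simps G0[THEN less_imp_neq, symmetric] del: of_nat_Suc)
  have "(\<lambda>k. measure N {\<omega> \<in> space N. Z \<omega> = k \<and> k \<in> E}) sums
      measure N (\<Union>k. {\<omega> \<in> space N. Z \<omega> = k \<and> k \<in> E})"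
    by (intro N.finite_measure_UNION) (auto simp: disjoint_family_on_def)
  also have "(\<Union>k. {\<omega> \<in> space N. Z \<omega> = k \<and> k \<in> E}) = {\<omega> \<in> space N. Z \<omega> \<in> E}" by auto
  also have "(\<lambda>k. measure N {\<omega> \<in> space N. Z \<omega> = k \<and> k \<in> E}) = (\<lambda>k. indicator E k * \<pi> k)"
    by (auto simp: \<pi>_def indicator_def)
  finally show "(\<lambda>k. indicator E k * \<pi> k) sums measure N {\<omega> \<in> space N. Z \<omega> \<in> E}" .
qed

section \<open>Order statistics and the number of points near them\<close>

text \<open>Without ties, the \<open>k\<close>-th order statistic is the unique sample point exceeded by exactly
  \<open>n - k\<close> of the others.\<close>

lemma order_stat_unique_index:
  fixes Y :: "nat \<Rightarrow> 'a \<Rightarrow> real"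
  assumes inj: "inj_on (\<lambda>i. Y i \<omega>) {1..n}" and k: "k \<in> {1..n}"
  obtains i where "i \<in> {1..n}" "order_stat Y n k \<omega> = Y i \<omega>"
    "\<And>i'. i' \<in> {1..n} \<Longrightarrow> card {j \<in> {1..n}. Y i' \<omega> < Y j \<omega>} = n - k \<longleftrightarrow> i' = i"
proof -
  define y where "y i = Y i \<omega>" for i
  have inj_y: "inj_on y {1..n}" using inj by (simp add: y_def[abs_def])
  define xs where "xs = sort (map y [1..<Suc n])"
  have set_xs: "set xs = y ` {1..n}" by (auto simp: xs_def)
  have dist: "distinct xs"
    using inj unfolding xs_def distinct_sort distinct_map set_upt atLeastLessThanSuc_atLeastAtMost
    by (simp add: y_def[abs_def])
  have len: "length xs = n" by (simp add: xs_def)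
  have strict: "xs ! a < xs ! b" if "a < b" "b < n" for a b
    using that dist len sorted_nth_mono[of xs a b] nth_eq_iff_index_eq[OF dist, of a b]
    by (simp add: xs_def[symmetric] less_le) (simp add: xs_def)
  have v: "order_stat Y n k \<omega> = xs ! (k - 1)"
    by (simp add: order_stat_def xs_def y_def[abs_def])
  have "xs ! (k - 1) \<in> set xs" using k len by (intro nth_mem) auto
  then obtain i where i: "i \<in> {1..n}" "xs ! (k - 1) = y i" unfolding set_xs by auto
  have card_i: "card {j \<in> {1..n}. y i < y j} = n - k"
  proof -
    have "{x \<in> set xs. y i < x} = (!) xs ` {k..<n}"
    proof (intro equalityI subsetI)
      fix x assume "x \<in> {x \<in> set xs. y i < x}"
      then obtain b where b: "b < n" "x = xs ! b" "xs ! (k - 1) < xs ! b"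
        unfolding i(2)[symmetric] using len by (auto simp: in_set_conv_nth)
      have "k - 1 < b"
      proof (rule ccontr)
        assume "\<not> k - 1 < b"
        hence "b = k - 1 \<or> b < k - 1" by linarith
        moreover have "k - 1 < n" using k by auto
        ultimately show False using strict[of b "k - 1"] b by auto
      qed
      thus "x \<in> (!) xs ` {k..<n}" using b by auto
    next
      fix x assume "x \<in> (!) xs ` {k..<n}"
      thus "x \<in> {x \<in> set xs. y i < x}"
        unfolding i(2)[symmetric] using k len by (auto intro!: strict)
    qed
    moreover have "inj_on ((!) xs) {k..<n}"
      using dist len by (auto simp: inj_on_def nth_eq_iff_index_eq)
    ultimately have "card {x \<in> set xs. y i < x} = n - k"
      by (simp add: card_image)
    moreover have "{x \<in> set xs. y i < x} = y ` {j \<in> {1..n}. y i < y j}"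
      unfolding set_xs by auto
    moreover have "inj_on y {j \<in> {1..n}. y i < y j}"
      by (rule inj_on_subset[OF inj_y]) auto
    ultimately show ?thesis by (simp add: card_image)
  qed
  have uniq: "i' = i" if i': "i' \<in> {1..n}" and c: "card {j \<in> {1..n}. y i' < y j} = n - k" for i'
  proof (rule ccontr)
    assume "i' \<noteq> i"
    hence "y i' \<noteq> y i" using inj_on_eq_iff[OF inj_y] i i' by auto
    moreover have no: False if "y u < y w" "w \<in> {1..n}" 
      "card {j \<in> {1..n}. y u < y j} = card {j \<in> {1..n}. y w < y j}" for u w
    proof -
      have "{j \<in> {1..n}. y w < y j} \<subset> {j \<in> {1..n}. y u < y j}" using that by auto
      from psubset_card_mono[OF _ this] show False using that(3) by simp
    qed
    ultimately show False using no[of i' i] no[of i i'] c card_i i i' by linarith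
  qed
  show ?thesis
  proof (rule that[of i])
    show "card {j \<in> {1..n}. Y i' \<omega> < Y j \<omega>} = n - k \<longleftrightarrow> i' = i" if "i' \<in> {1..n}" for i'
      using uniq[OF that] card_i unfolding y_def by blast
  qed (use i v in \<open>simp_all add: y_def\<close>)
qed

text \<open>Without ties, the count is decomposed according to which sample point is the order
  statistic; each summand refers to the remaining points through two cell counts only.\<close>

lemma near_order_stat_count_distinct:
  fixes Y :: "nat \<Rightarrow> 'a \<Rightarrow> real"
  assumes inj: "inj_on (\<lambda>i. Y i \<omega>) {1..n}" and l: "1 \<le> l" "l \<le> n" and a: "a > 0"
  shows "(if near_order_stat_count Y n a l \<omega> - 1 = k then 1 else 0) =
    (\<Sum>i\<in>{1..n}. if card {j \<in> {1..n} - {i}. Y j \<omega> \<in> {Y i \<omega><..}} = l - 1 \<and>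
                       card {j \<in> {1..n} - {i}. Y j \<omega> \<in> {Y i \<omega> - a<..Y i \<omega>}} = k
                    then 1 else (0 :: 'b :: semiring_1))"
proof -
  have "n - l + 1 \<in> {1..n}" using l by auto
  then obtain i where i: "i \<in> {1..n}" "order_stat Y n (n - l + 1) \<omega> = Y i \<omega>"
    and uniq: "\<And>i'. i' \<in> {1..n} \<Longrightarrow>
      card {j \<in> {1..n}. Y i' \<omega> < Y j \<omega>} = n - (n - l + 1) \<longleftrightarrow> i' = i"
    using order_stat_unique_index[where Y=Y and \<omega>=\<omega>, OF inj] by blast
  have above: "{j \<in> {1..n} - {i'}. Y j \<omega> \<in> {Y i' \<omega><..}} = {j \<in> {1..n}. Y i' \<omega> < Y j \<omega>}" for i'
    by auto
  have nl: "n - (n - l + 1) = l - 1" using l by simp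
  have "{j \<in> {1..n}. Y i \<omega> - a < Y j \<omega> \<and> Y j \<omega> \<le> Y i \<omega>} =
      insert i {j \<in> {1..n} - {i}. Y j \<omega> \<in> {Y i \<omega> - a<..Y i \<omega>}}"
    using i a by auto
  hence "near_order_stat_count Y n a l \<omega> =
      card (insert i {j \<in> {1..n} - {i}. Y j \<omega> \<in> {Y i \<omega> - a<..Y i \<omega>}})"
    unfolding near_order_stat_count_def i by simp
  also have "\<dots> = Suc (card {j \<in> {1..n} - {i}. Y j \<omega> \<in> {Y i \<omega> - a<..Y i \<omega>}})"
    by (subst card_insert_disjoint) auto
  finally have K: "near_order_stat_count Y n a l \<omega> - 1 = 
      card {j \<in> {1..n} - {i}. Y j \<omega> \<in> {Y i \<omega> - a<..Y i \<omega>}}" by simp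
  have "(\<Sum>i'\<in>{1..n}. if card {j \<in> {1..n} - {i'}. Y j \<omega> \<in> {Y i' \<omega><..}} = l - 1 \<and>
                       card {j \<in> {1..n} - {i'}. Y j \<omega> \<in> {Y i' \<omega> - a<..Y i' \<omega>}} = k
                    then 1 else (0 :: 'b)) =
     (\<Sum>i'\<in>{1..n}. if i' = i then 
        (if card {j \<in> {1..n} - {i}. Y j \<omega> \<in> {Y i \<omega> - a<..Y i \<omega>}} = k then 1 else 0) else 0)"
    unfolding above using uniq nl by (intro sum.cong) auto
  also have "\<dots> = (if near_order_stat_count Y n a l \<omega> - 1 = k then 1 else 0)"
    using i K by simp
  finally show ?thesis ..
qed

lemma near_order_stat_count_bounds:
  assumes l: "1 \<le> l" "l \<le> n" and a: "a > 0"
  shows "1 \<le> near_order_stat_count Y n a l \<omega>" "near_order_stat_count Y n a l \<omega> \<le> n"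
proof -
  let ?v = "order_stat Y n (n - l + 1) \<omega>"
  have "?v \<in> set (sort (map (\<lambda>i. Y i \<omega>) [1..<Suc n]))"
    unfolding order_stat_def using l by (intro nth_mem) auto
  also have "\<dots> = (\<lambda>i. Y i \<omega>) ` {1..n}"
    unfolding set_sort set_map set_upt atLeastLessThanSuc_atLeastAtMost ..
  finally obtain i where "i \<in> {1..n}" "?v = Y i \<omega>" by auto
  hence "{i \<in> {1..n}. ?v - a < Y i \<omega> \<and> Y i \<omega> \<le> ?v} \<noteq> {}" using a by (auto intro!: exI[of _ i])
  thus "1 \<le> near_order_stat_count Y n a l \<omega>"
    unfolding near_order_stat_count_def by (simp add: Suc_le_eq card_gt_0_iff)
  have "card {i \<in> {1..n}. ?v - a < Y i \<omega> \<and> Y i \<omega> \<le> ?v} \<le> card {1..n}"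
    by (intro card_mono) auto
  thus "near_order_stat_count Y n a l \<omega> \<le> n"
    unfolding near_order_stat_count_def by simp
qed

text \<open>The description of the order statistics through counts is what makes them measurable.\<close>

lemma order_stat_le_iff:
  assumes k: "k \<in> {1..n}"
  shows "order_stat Y n k \<omega> \<le> c \<longleftrightarrow> k \<le> card {i \<in> {1..n}. Y i \<omega> \<le> c}"
proof -
  define ys where "ys = map (\<lambda>i. Y i \<omega>) [1..<Suc n]"
  have len: "length (sort ys) = n" by (simp add: ys_def)
  have "card {i \<in> {1..n}. Y i \<omega> \<le> c} = length (filter (\<lambda>x. x \<le> c) ys)"
  proof -
    have "length (filter (\<lambda>x. x \<le> c) ys) = card (set (filter (\<lambda>i. Y i \<omega> \<le> c) [1..<Suc n]))"
      unfolding ys_def filter_map length_map o_def by (subst distinct_card) auto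
    also have "set (filter (\<lambda>i. Y i \<omega> \<le> c) [1..<Suc n]) = {i \<in> {1..n}. Y i \<omega> \<le> c}"
      by auto
    finally show ?thesis ..
  qed
  also have "\<dots> = length (filter (\<lambda>x. x \<le> c) (sort ys))"
    by (simp add: filter_sort)
  also have "\<dots> = card {b. b < n \<and> sort ys ! b \<le> c}"
    unfolding length_filter_conv_card len ..
  finally have eq: "card {i \<in> {1..n}. Y i \<omega> \<le> c} = card {b. b < n \<and> sort ys ! b \<le> c}" .
  have mono: "sort ys ! b \<le> sort ys ! b'" if "b \<le> b'" "b' < n" for b b'
    using that len by (intro sorted_nth_mono) auto
  have v: "order_stat Y n k \<omega> = sort ys ! (k - 1)" by (simp add: order_stat_def ys_def)
  show ?thesis
  proof
    assume "order_stat Y n k \<omega> \<le> c"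
    hence *: "sort ys ! (k - 1) \<le> c" by (simp add: v)
    have "b < n \<and> sort ys ! b \<le> c" if "b < k" for b
    proof -
      have "sort ys ! b \<le> sort ys ! (k - 1)" using that k by (intro mono) auto
      thus ?thesis using that k * by auto
    qed
    hence "{..<k} \<subseteq> {b. b < n \<and> sort ys ! b \<le> c}" by auto
    hence "card {..<k} \<le> card {b. b < n \<and> sort ys ! b \<le> c}" by (intro card_mono) auto
    thus "k \<le> card {i \<in> {1..n}. Y i \<omega> \<le> c}" unfolding eq by simp
  next
    have k1: "1 \<le> k" using k by simp
    assume *: "k \<le> card {i \<in> {1..n}. Y i \<omega> \<le> c}"
    show "order_stat Y n k \<omega> \<le> c"
    proof (rule ccontr)
      assume less: "\<not> order_stat Y n k \<omega> \<le> c"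
      have "{b. b < n \<and> sort ys ! b \<le> c} \<subseteq> {..<k - 1}"
      proof
        fix b assume b: "b \<in> {b. b < n \<and> sort ys ! b \<le> c}"
        show "b \<in> {..<k - 1}"
        proof (rule ccontr)
          assume "b \<notin> {..<k - 1}"
          hence "sort ys ! (k - 1) \<le> sort ys ! b" using b by (intro mono) auto
          thus False using less b unfolding v by auto
        qed
      qed
      hence "card {b. b < n \<and> sort ys ! b \<le> c} \<le> card {..<k - 1}" by (intro card_mono) auto
      thus False using *[unfolded eq] k1 by simp
    qed
  qed
qed

lemma near_order_stat_count_measurable:
  assumes X: "\<And>i. i \<in> {1..n} \<Longrightarrow> X i \<in> borel_measurable M" and l: "1 \<le> l" "l \<le> n"
  shows "near_order_stat_count X n a l \<in> measurable M (count_space UNIV)"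
proof -
  have pred: "Measurable.pred M (\<lambda>\<omega>. i \<in> {1..n} \<and> Q \<omega> (X i \<omega>))"
    if Q: "Measurable.pred (M \<Otimes>\<^sub>M borel) (\<lambda>(\<omega>, x). Q \<omega> x)" for i and Q :: "_ \<Rightarrow> real \<Rightarrow> bool"
  proof (cases "i \<in> {1..n}")
    case True
    note [measurable] = X[OF True] Q
    have "Measurable.pred M (\<lambda>\<omega>. case (\<omega>, X i \<omega>) of (\<omega>, x) \<Rightarrow> Q \<omega> x)" by measurable
    thus ?thesis using True by simp
  next
    case False
    hence "(\<lambda>\<omega>. i \<in> {1..n} \<and> Q \<omega> (X i \<omega>)) = (\<lambda>_. False)" by auto
    thus ?thesis by (simp only: measurable_const UNIV_I space_count_space)
  qed
  have [measurable]: "order_stat X n (n - l + 1) \<in> borel_measurable M"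
  proof (rule borel_measurableI_le)
    fix c
    have [measurable]: "(\<lambda>\<omega>. card {i \<in> {1..n}. X i \<omega> \<le> c}) \<in> measurable M (count_space UNIV)"
      by (rule measurable_card, rule pred_def[THEN iffD1], unfold mem_Collect_eq,
          rule pred[where Q="\<lambda>\<omega> x. x \<le> c"]) measurable
    have "n - l + 1 \<in> {1..n}" using l by auto
    thus "{\<omega> \<in> space M. order_stat X n (n - l + 1) \<omega> \<le> c} \<in> sets M"
      unfolding order_stat_le_iff[OF \<open>n - l + 1 \<in> {1..n}\<close>] by measurable
  qed
  show ?thesis
    unfolding near_order_stat_count_def
    by (rule measurable_card, rule pred_def[THEN iffD1], unfold mem_Collect_eq,
        rule pred[where Q="\<lambda>\<omega> x. order_stat X n (n - l + 1) \<omega> - a < x \<and>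
                                  x \<le> order_stat X n (n - l + 1) \<omega>"]) measurable
qed

section \<open>The law of the number of near points\<close>

text \<open>For independent \<open>D\<close>-distributed points, the numbers falling into two disjoint sets are
  trinomially distributed. If \<open>s + k\<close> exceeds the number of points, the binomial coefficients
  vanish.\<close>

lemma measure_PiM_trinomial:
  fixes D :: "'b measure" and J :: "'i set"
  assumes "prob_space D" and J: "finite J"
    and [measurable]: "U \<in> sets D" "V \<in> sets D" and UV: "U \<inter> V = {}"
  shows "measure (PiM J (\<lambda>_. D)) {y \<in> space (PiM J (\<lambda>_. D)).
           card {j \<in> J. y j \<in> U} = s \<and> card {j \<in> J. y j \<in> V} = k} =
     real (card J choose s) * real ((card J - s) choose k) *
     measure D U ^ s * measure D V ^ k * measure D (space D - (U \<union> V)) ^ (card J - s - k)"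
proof -
  interpret D: prob_space D by fact
  interpret P: finite_product_prob_space "\<lambda>_. D" J by standard fact
  let ?P = "PiM J (\<lambda>_. D)" and ?W = "space D - (U \<union> V)"
  \<comment> \<open>The event splits into product boxes, indexed by the set \<open>S\<close> of the points in \<open>U\<close> and the set
      \<open>T\<close> of those in \<open>V\<close>.\<close>
  define Idx where "Idx = Sigma {S. S \<subseteq> J \<and> card S = s} (\<lambda>S. {T. T \<subseteq> J - S \<and> card T = k})"
  define box where "box = (\<lambda>(S, T). PiE J (\<lambda>j. if j \<in> S then U else if j \<in> T then V else ?W))"
  have fin: "finite Idx"
    unfolding Idx_def using J by (intro finite_SigmaI) auto
  have card_Idx: "card Idx = (card J choose s) * ((card J - s) choose k)"
  proof -
    have "card Idx = (\<Sum>S\<in>{S. S \<subseteq> J \<and> card S = s}. card {T. T \<subseteq> J - S \<and> card T = k})"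
      unfolding Idx_def using J by (intro card_SigmaI) auto
    also have "\<dots> = (\<Sum>S\<in>{S. S \<subseteq> J \<and> card S = s}. (card J - s) choose k)"
      using J by (intro sum.cong) (auto simp: n_subsets card_Diff_subset finite_subset)
    finally show ?thesis using J by (simp add: n_subsets)
  qed
  have box: "{j \<in> J. y j \<in> U} = S" "{j \<in> J. y j \<in> V} = T"
    if ST: "(S, T) \<in> Idx" "y \<in> box (S, T)" for S T y
  proof -
    have sub: "S \<subseteq> J" "T \<subseteq> J" "S \<inter> T = {}" using ST(1) by (auto simp: Idx_def)
    have "(y j \<in> U \<longleftrightarrow> j \<in> S) \<and> (y j \<in> V \<longleftrightarrow> j \<in> T)" if "j \<in> J" for j
    proof -
      have "y j \<in> (if j \<in> S then U else if j \<in> T then V else ?W)"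
        using ST(2) that by (auto simp: box_def PiE_def Pi_def)
      thus ?thesis using UV sub(3) by (auto split: if_splits)
    qed
    thus "{j \<in> J. y j \<in> U} = S" "{j \<in> J. y j \<in> V} = T" using sub by auto
  qed
  have eq: "{y \<in> space ?P. card {j \<in> J. y j \<in> U} = s \<and> card {j \<in> J. y j \<in> V} = k} = (\<Union>p\<in>Idx. box p)"
  proof (intro equalityI subsetI)
    fix y assume y: "y \<in> {y \<in> space ?P. card {j \<in> J. y j \<in> U} = s \<and> card {j \<in> J. y j \<in> V} = k}"
    have "({j \<in> J. y j \<in> U}, {j \<in> J. y j \<in> V}) \<in> Idx" using y UV by (auto simp: Idx_def)
    moreover have "y \<in> box ({j \<in> J. y j \<in> U}, {j \<in> J. y j \<in> V})"
      using y by (auto simp: box_def space_PiM PiE_def Pi_def)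
    ultimately show "y \<in> (\<Union>p\<in>Idx. box p)" by blast
  next
    fix y assume "y \<in> (\<Union>p\<in>Idx. box p)"
    then obtain S T where ST: "(S, T) \<in> Idx" "y \<in> box (S, T)" by auto
    have sub: "card S = s" "card T = k" using ST(1) by (auto simp: Idx_def)
    have "y \<in> space ?P"
      using ST(2) sets.sets_into_space[of U D] sets.sets_into_space[of V D]
      by (fastforce simp: box_def space_PiM PiE_def Pi_def split: if_splits)
    thus "y \<in> {y \<in> space ?P. card {j \<in> J. y j \<in> U} = s \<and> card {j \<in> J. y j \<in> V} = k}"
      using sub box[OF ST] by simp
  qed
  have disj: "disjoint_family_on box Idx"
    unfolding disjoint_family_on_def
  proof (intro ballI impI)
    fix p q assume pq: "p \<in> Idx" "q \<in> Idx" "p \<noteq> q"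
    show "box p \<inter> box q = {}"
    proof (rule ccontr)
      assume "box p \<inter> box q \<noteq> {}"
      then obtain y where y: "y \<in> box p" "y \<in> box q" by auto
      show False using box[of "fst p" "snd p" y] box[of "fst q" "snd q" y] y pq
        by (metis prod.collapse)
    qed
  qed
  have meas: "measure ?P (box p) = measure D U ^ s * measure D V ^ k * measure D ?W ^ (card J - s - k)"
    if p: "p \<in> Idx" for p
  proof -
    obtain S T where ST: "p = (S, T)" by (cases p)
    have sub: "S \<subseteq> J" "T \<subseteq> J - S" "card S = s" "card T = k"
      using p by (auto simp: Idx_def ST)
    have fin: "finite S" "finite T" using sub J by (auto intro: finite_subset)
    have "measure ?P (box p) =
        (\<Prod>j\<in>J. measure D (if j \<in> S then U else if j \<in> T then V else ?W))"
      unfolding ST box_def prod.case by (intro P.finite_measure_PiM_emb) auto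
    also have "\<dots> = (\<Prod>j\<in>J - S - T. measure D (if j \<in> S then U else if j \<in> T then V else ?W)) *
        (\<Prod>j\<in>T. measure D (if j \<in> S then U else if j \<in> T then V else ?W)) * (\<Prod>j\<in>S. measure D (if j \<in> S then U else if j \<in> T then V else ?W))"
      by (simp only: prod.subset_diff[OF sub(1) J] prod.subset_diff[OF sub(2) finite_Diff[OF J]] mult.assoc)
    also have "(\<Prod>j\<in>S. measure D (if j \<in> S then U else if j \<in> T then V else ?W)) = (\<Prod>j\<in>S. measure D U)"
      by (intro prod.cong) auto
    also have "(\<Prod>j\<in>T. measure D (if j \<in> S then U else if j \<in> T then V else ?W)) = (\<Prod>j\<in>T. measure D V)"
      using sub by (intro prod.cong) auto
    also have "(\<Prod>j\<in>J-S-T. measure D (if j \<in> S then U else if j \<in> T then V else ?W)) = (\<Prod>j\<in>J-S-T. measure D ?W)"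
      by (intro prod.cong) auto
    also have "card (J - S - T) = card J - s - k"
      using sub fin by (simp add: card_Diff_subset)
    hence "(\<Prod>j\<in>J-S-T. measure D ?W) = measure D ?W ^ (card J - s - k)" by simp
    finally show ?thesis using sub by (simp add: mult_ac)
  qed
  have sets: "box ` Idx \<subseteq> sets ?P"
    using J by (auto simp: box_def intro!: sets_PiM_I_finite)
  have "measure ?P (\<Union>p\<in>Idx. box p) = (\<Sum>p\<in>Idx. measure ?P (box p))"
    using fin sets disj by (rule P.finite_measure_finite_Union)
  also have "\<dots> = real (card Idx) * (measure D U ^ s * measure D V ^ k * measure D ?W ^ (card J - s - k))"
    using meas by simp
  finally show ?thesis unfolding eq card_Idx by (simp add: mult_ac)
qed

text \<open>The trinomial law with the two sets depending on the value of one distinguished coordinate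
  \<open>i\<close>: conditionally on that value, the other coordinates are still independent.\<close>

lemma emeasure_PiM_slice_trinomial:
  fixes D :: "'b measure" and I :: "nat set"
  assumes D: "prob_space D" and I: "finite I" and i: "i \<in> I"
    and U: "Measurable.pred (D \<Otimes>\<^sub>M D) (\<lambda>(x, y). y \<in> U x)"
    and V: "Measurable.pred (D \<Otimes>\<^sub>M D) (\<lambda>(x, y). y \<in> V x)"
    and UV: "\<And>x. U x \<inter> V x = {}" "\<And>x. U x \<subseteq> space D" "\<And>x. V x \<subseteq> space D"
  shows "{y \<in> space (PiM I (\<lambda>_. D)). card {j \<in> I - {i}. y j \<in> U (y i)} = s \<and>
             card {j \<in> I - {i}. y j \<in> V (y i)} = k} \<in> sets (PiM I (\<lambda>_. D))" (is "?A \<in> _")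
    and "emeasure (PiM I (\<lambda>_. D)) {y \<in> space (PiM I (\<lambda>_. D)).
           card {j \<in> I - {i}. y j \<in> U (y i)} = s \<and> card {j \<in> I - {i}. y j \<in> V (y i)} = k} =
     (\<integral>\<^sup>+x. ennreal (real (card I - 1 choose s) * real ((card I - 1 - s) choose k) *
       measure D (U x) ^ s * measure D (V x) ^ k *
       measure D (space D - (U x \<union> V x)) ^ (card I - 1 - s - k)) \<partial>D)"
proof -
  interpret D: prob_space D by fact
  interpret P: product_prob_space "\<lambda>_. D" I by standard
  define J where "J = I - {i}"
  have J: "finite J" "i \<notin> J" "insert i J = I" "card J = card I - 1" using I i by (auto simp: J_def)
  let ?P = "PiM I (\<lambda>_. D)"
  have pred: "Measurable.pred ?P (\<lambda>y. j \<in> J \<and> y j \<in> W (y i))"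
    if W: "Measurable.pred (D \<Otimes>\<^sub>M D) (\<lambda>(x, y). y \<in> W x)" for j W
  proof (cases "j \<in> J")
    case True
    hence [measurable]: "(\<lambda>y. (y i, y j)) \<in> measurable ?P (D \<Otimes>\<^sub>M D)" using i by (auto simp: J_def)
    note [measurable] = W
    have "Measurable.pred ?P (\<lambda>y. case (y i, y j) of (x, y) \<Rightarrow> y \<in> W x)" by measurable
    thus ?thesis using True by simp
  qed simp
  have m: "(\<lambda>y. card {j \<in> J. y j \<in> W (y i)}) \<in> measurable ?P (count_space UNIV)"
    if W: "Measurable.pred (D \<Otimes>\<^sub>M D) (\<lambda>(x, y). y \<in> W x)" for W
    by (rule measurable_card, rule pred_def[THEN iffD1], unfold mem_Collect_eq, rule pred, rule W)
  note [measurable] = m[OF U] m[OF V]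
  have A: "?A \<in> sets ?P" unfolding J_def[symmetric] by measurable
  thus "?A \<in> sets ?P" .
  have slice: "W x \<in> sets D"
    if "Measurable.pred (D \<Otimes>\<^sub>M D) (\<lambda>(x, y). y \<in> W x)" "x \<in> space D" "W x \<subseteq> space D" for W x
  proof -
    have "(\<lambda>y. (x, y)) \<in> measurable D (D \<Otimes>\<^sub>M D)" using that(2) by measurable
    from measurable_compose[OF this that(1)] have "Measurable.pred D (\<lambda>y. y \<in> W x)" by simp
    hence "{y \<in> space D. y \<in> W x} \<in> sets D" by (simp add: pred_def)
    also have "{y \<in> space D. y \<in> W x} = W x" using that(3) by auto
    finally show ?thesis .
  qed
  have "emeasure ?P ?A = (\<integral>\<^sup>+y. indicator ?A y \<partial>?P)"
    by (rule nn_integral_indicator[OF A, symmetric])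
  also have "\<dots> = (\<integral>\<^sup>+x. \<integral>\<^sup>+z. indicator ?A (z(i := x)) \<partial>PiM J (\<lambda>_. D) \<partial>D)"
    by (rule P.product_nn_integral_insert_rev[OF J(1,2), of "indicator ?A", unfolded J(3)])
       (intro borel_measurable_indicator A)
  also have "\<dots> = (\<integral>\<^sup>+x. ennreal (real (card I - 1 choose s) * real ((card I - 1 - s) choose k) *
       measure D (U x) ^ s * measure D (V x) ^ k *
       measure D (space D - (U x \<union> V x)) ^ (card I - 1 - s - k)) \<partial>D)"
  proof (rule nn_integral_cong)
    fix x assume x: "x \<in> space D"
    interpret PJ: finite_product_prob_space "\<lambda>_. D" J by standard (rule J)
    let ?PJ = "PiM J (\<lambda>_. D)"
    let ?B = "{z \<in> space ?PJ. card {j \<in> J. z j \<in> U x} = s \<and> card {j \<in> J. z j \<in> V x} = k}"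
    have UVx [measurable]: "U x \<in> sets D" "V x \<in> sets D"
      using slice U V UV x by auto
    have cnt: "(\<lambda>z. card {j \<in> J. z j \<in> W}) \<in> measurable ?PJ (count_space UNIV)" if [measurable]: "W \<in> sets D" for W
    proof (rule measurable_card)
      show "{z \<in> space ?PJ. j \<in> {j \<in> J. z j \<in> W}} \<in> sets ?PJ" for j
        by (cases "j \<in> J") auto
    qed
    note [measurable] = cnt[OF UVx(1)] cnt[OF UVx(2)]
    have B: "?B \<in> sets ?PJ" by measurable
    have "(\<integral>\<^sup>+z. indicator ?A (z(i := x)) \<partial>?PJ) = (\<integral>\<^sup>+z. indicator ?B z \<partial>?PJ)"
    proof (rule nn_integral_cong)
      fix z assume z: "z \<in> space ?PJ"
      have "z(i := x) \<in> space ?P"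
        using z x J by (auto simp: space_PiM PiE_def extensional_def Pi_def J_def)
      moreover have "{j \<in> J. (z(i := x)) j \<in> W} = {j \<in> J. z j \<in> W}" for W
        using J(2) by auto
      ultimately show "indicator ?A (z(i := x)) = (indicator ?B z :: ennreal)"
        using z unfolding J_def[symmetric] by (simp add: indicator_def)
    qed
    also have "\<dots> = ennreal (measure ?PJ ?B)"
      using B by (simp add: PJ.emeasure_eq_measure)
    also have "measure ?PJ ?B = real (card J choose s) * real ((card J - s) choose k) *
       measure D (U x) ^ s * measure D (V x) ^ k * measure D (space D - (U x \<union> V x)) ^ (card J - s - k)"
      using D J(1) UVx UV(1) by (rule measure_PiM_trinomial)
    finally show "(\<integral>\<^sup>+z. indicator ?A (z(i := x)) \<partial>?PJ) = ennreal (real (card I - 1 choose s) * real ((card I - 1 - s) choose k) *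
       measure D (U x) ^ s * measure D (V x) ^ k *
       measure D (space D - (U x \<union> V x)) ^ (card I - 1 - s - k))"
      unfolding J(4) .
  qed
  finally show "emeasure ?P ?A = \<dots>" .
qed

text \<open>The exact law of the count in terms of the distribution function \<open>F\<close> of the sample:
  there are \<open>n\<close> choices for the sample point that is the order statistic, and given its value
  \<open>x\<close> the others lie above \<open>x\<close>, in the window \<open>(x - a, x]\<close>, or below the window.\<close>

lemma emeasure_near_order_stat_count:
  fixes X :: "nat \<Rightarrow> 'a \<Rightarrow> real"
  assumes M: "prob_space M" and n: "n \<ge> 1" and l: "1 \<le> l" "l \<le> n" and a: "a > 0"
    and indep: "prob_space.indep_vars M (\<lambda>_. borel) X {1..n}"
    and D: "\<And>i. i \<in> {1..n} \<Longrightarrow> distr M borel (X i) = D"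
    and atomless: "\<And>x. measure D {x} = 0"
  shows "emeasure M {\<omega> \<in> space M. near_order_stat_count X n a l \<omega> - 1 = k} =
    (\<integral>\<^sup>+x. ennreal (real n * real (n - 1 choose (l - 1)) * real (n - l choose k) *
       (1 - cdf D x) ^ (l - 1) * (cdf D x - cdf D (x - a)) ^ k *
       cdf D (x - a) ^ (n - l - k)) \<partial>D)"
proof -
  interpret M: prob_space M by fact
  let ?I = "{1..n}"
  have rv: "X i \<in> borel_measurable M" if "i \<in> ?I" for i
    using indep that by (auto simp: M.indep_vars_def2)
  have D1: "D = distr M borel (X 1)" using D[of 1] n by simp
  have sD [measurable_cong]: "sets D = sets borel" and spD: "space D = UNIV" by (simp_all add: D1)
  have pD: "prob_space D" unfolding D1 using n by (intro M.prob_space_distr rv) auto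
  interpret D: prob_space D by fact
  interpret P: finite_product_prob_space "\<lambda>_. D" ?I by standard auto
  interpret RD: real_distribution D by standard (simp_all add: sD spD)
  have cdf_borel [measurable]: "cdf D \<in> borel_measurable borel"
    by (intro borel_measurable_mono monoI RD.cdf_nondecreasing)
  let ?P = "PiM ?I (\<lambda>_. D)"
  have sP: "sets ?P = sets (PiM ?I (\<lambda>_. borel))" by (intro sets_PiM_cong) (auto simp: sD)
  define T where "T \<omega> = (\<lambda>i\<in>?I. X i \<omega>)" for \<omega>
  have T [measurable]: "T \<in> measurable M ?P"
    unfolding T_def measurable_cong_sets[OF refl sP] using rv by (intro measurable_restrict) auto
  have distT: "distr M ?P T = ?P"
  proof -
    have "distr M ?P T = distr M (PiM ?I (\<lambda>_. borel)) T"
      by (intro distr_cong refl sP)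
    also have "\<dots> = PiM ?I (\<lambda>i. distr M borel (X i))"
      unfolding T_def using indep rv n by (subst M.indep_vars_iff_distr_eq_PiM'[symmetric]) auto
    also have "\<dots> = ?P" by (intro PiM_cong) (auto simp: D)
    finally show ?thesis .
  qed
  define K where "K = near_order_stat_count (\<lambda>i y. y i :: real) n a l"
  have K_T: "near_order_stat_count X n a l \<omega> = K (T \<omega>)" for \<omega>
  proof -
    have "order_stat X n k \<omega> = order_stat (\<lambda>i y. y i) n k (T \<omega>)" for k
      unfolding order_stat_def T_def
      by (intro arg_cong2[where f=nth] arg_cong[where f=sort] map_cong) auto
    thus ?thesis
      unfolding K_def near_order_stat_count_def
      by (intro arg_cong[where f=card]) (auto simp: T_def)
  qed
  have K [measurable]: "K \<in> measurable ?P (count_space UNIV)"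
    unfolding K_def using l by (intro near_order_stat_count_measurable) measurable
  have "emeasure M {\<omega> \<in> space M. near_order_stat_count X n a l \<omega> - 1 = k} =
      emeasure (distr M ?P T) {y \<in> space ?P. K y - 1 = k}"
  proof (subst emeasure_distr)
    show "{y \<in> space ?P. K y - 1 = k} \<in> sets ?P" by measurable
    show "emeasure M {\<omega> \<in> space M. near_order_stat_count X n a l \<omega> - 1 = k} =
        emeasure M (T -` {y \<in> space ?P. K y - 1 = k} \<inter> space M)"
      using measurable_space[OF T] by (intro arg_cong[where f="emeasure M"]) (auto simp: K_T)
  qed (rule T)
  also have "\<dots> = emeasure ?P {y \<in> space ?P. K y - 1 = k}" unfolding distT ..
  also have "\<dots> = (\<integral>\<^sup>+y. (if K y - 1 = k then 1 else 0) \<partial>?P)"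
    by (subst nn_integral_indicator[symmetric], measurable)
       (auto intro!: nn_integral_cong simp: indicator_def)
  finally have 1: "emeasure M {\<omega> \<in> space M. near_order_stat_count X n a l \<omega> - 1 = k} = \<dots>" .
  \<comment> \<open>Almost surely there are no ties: conditionally on \<open>y i = x\<close>, the number of other coordinates
      in the null set \<open>{x}\<close> is \<open>0\<close>, which is a case of the trinomial law.\<close>
  have ne: "AE y in ?P. {j \<in> ?I - {i}. y j \<in> {y i}} = {}" if i: "i \<in> ?I" for i
  proof -
    let ?A = "{y \<in> space ?P. card {j \<in> ?I - {i}. y j \<in> {y i}} = 0 \<and> card {j \<in> ?I - {i}. y j \<in> {}} = 0}"
    have p: "Measurable.pred (D \<Otimes>\<^sub>M D) (\<lambda>(x, y). y \<in> {x})" 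
            "Measurable.pred (D \<Otimes>\<^sub>M D) (\<lambda>(x, y). y \<in> {})"
      unfolding singleton_iff empty_iff by measurable
    have A: "?A \<in> sets ?P"
      by (rule emeasure_PiM_slice_trinomial(1)[OF pD _ i p]) (auto simp: spD)
    have "emeasure ?P ?A = (\<integral>\<^sup>+x. ennreal 1 \<partial>D)"
    proof (subst emeasure_PiM_slice_trinomial(2)[OF pD _ i p])
      have "measure D (space D - {x}) = 1" for x
        using D.prob_compl[of "{x}"] atomless[of x] by (simp add: sD)
      thus "(\<integral>\<^sup>+x. ennreal (real (card ?I - 1 choose 0) * real (card ?I - 1 - 0 choose 0) *
         measure D {x} ^ 0 * measure D {} ^ 0 * measure D (space D - ({x} \<union> {})) ^ (card ?I - 1 - 0 - 0)) \<partial>D)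
         = (\<integral>\<^sup>+x. ennreal 1 \<partial>D)" by simp
    qed (auto simp: spD)
    hence "measure ?P ?A = 1" unfolding measure_def by (simp add: D.emeasure_space_1[unfolded spD])
    hence "AE y in ?P. y \<in> ?A" by (rule P.AE_in_set_eq_1[OF A, THEN iffD2])
    thus ?thesis
    proof eventually_elim
      fix y assume "y \<in> ?A"
      hence "card {j \<in> ?I - {i}. y j \<in> {y i}} = 0" by blast
      thus "{j \<in> ?I - {i}. y j \<in> {y i}} = {}" by (subst (asm) card_0_eq) auto
    qed
  qed
  have "AE y in ?P. \<forall>i\<in>?I. {j \<in> ?I - {i}. y j \<in> {y i}} = {}"
    using ne by (intro AE_finite_allI) auto
  hence inj: "AE y in ?P. inj_on (\<lambda>i. y i) ?I"
  proof eventually_elim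
    fix y :: "nat \<Rightarrow> real" assume *: "\<forall>i\<in>?I. {j \<in> ?I - {i}. y j \<in> {y i}} = {}"
    show "inj_on (\<lambda>i. y i) ?I"
    proof (rule inj_onI, rule ccontr)
      fix i j assume "i \<in> ?I" "j \<in> ?I" "y i = y j" "i \<noteq> j"
      hence "j \<in> {j \<in> ?I - {i}. y j \<in> {y i}}" by simp
      thus False using * \<open>i \<in> ?I\<close> by blast
    qed
  qed
  let ?c = "\<lambda>i y. card {j \<in> ?I - {i}. y j \<in> {y i<..}} = l - 1 \<and> card {j \<in> ?I - {i}. y j \<in> {y i - a<..y i}} = k"
  have "(\<integral>\<^sup>+y. (if K y - 1 = k then 1 else 0) \<partial>?P) = (\<integral>\<^sup>+y. (\<Sum>i\<in>?I. if ?c i y then 1 else 0) \<partial>?P)"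
  proof (rule nn_integral_cong_AE, use inj in eventually_elim)
    fix y :: "nat \<Rightarrow> real" assume "inj_on (\<lambda>i. y i) ?I"
    thus "(if K y - 1 = k then 1 else 0) = (\<Sum>i\<in>?I. if ?c i y then 1 else (0 :: ennreal))"
      unfolding K_def using l a by (intro near_order_stat_count_distinct) auto
  qed
  also have "\<dots> = (\<integral>\<^sup>+y. (\<Sum>i\<in>?I. indicator {y \<in> space ?P. ?c i y} y) \<partial>?P)"
    by (intro nn_integral_cong sum.cong) (auto simp: indicator_def)
  also have "\<dots> = (\<Sum>i\<in>?I. emeasure ?P {y \<in> space ?P. ?c i y})"
  proof -
    have p: "Measurable.pred (D \<Otimes>\<^sub>M D) (\<lambda>(x, y). y \<in> {x<..})"
            "Measurable.pred (D \<Otimes>\<^sub>M D) (\<lambda>(x, y). y \<in> {x - a<..x})"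
      unfolding greaterThan_iff greaterThanAtMost_iff by measurable
    have c: "{y \<in> space ?P. ?c i y} \<in> sets ?P" if "i \<in> ?I" for i
      by (rule emeasure_PiM_slice_trinomial(1)[OF pD _ that p]) (auto simp: spD)
    show ?thesis
      by (subst nn_integral_sum)
         (intro borel_measurable_indicator c sum.cong refl nn_integral_indicator; assumption)+
  qed
  also have "\<dots> = (\<Sum>i\<in>?I. \<integral>\<^sup>+x. ennreal (real (card ?I - 1 choose (l - 1)) * real ((card ?I - 1 - (l - 1)) choose k) *
       measure D {x<..} ^ (l - 1) * measure D {x - a<..x} ^ k *
       measure D (space D - ({x<..} \<union> {x - a<..x})) ^ (card ?I - 1 - (l - 1) - k)) \<partial>D)"
  proof (intro sum.cong refl)
    fix i assume i: "i \<in> ?I"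
    have p: "Measurable.pred (D \<Otimes>\<^sub>M D) (\<lambda>(x, y). y \<in> {x<..})"
            "Measurable.pred (D \<Otimes>\<^sub>M D) (\<lambda>(x, y). y \<in> {x - a<..x})"
      unfolding greaterThan_iff greaterThanAtMost_iff by measurable
    show "emeasure ?P {y \<in> space ?P. ?c i y} =
      (\<integral>\<^sup>+x. ennreal (real (card ?I - 1 choose (l - 1)) * real ((card ?I - 1 - (l - 1)) choose k) *
       measure D {x<..} ^ (l - 1) * measure D {x - a<..x} ^ k *
       measure D (space D - ({x<..} \<union> {x - a<..x})) ^ (card ?I - 1 - (l - 1) - k)) \<partial>D)"
      by (rule emeasure_PiM_slice_trinomial(2)[OF pD _ i p]) (auto simp: spD)
  qed
  also have "\<dots> = of_nat n * (\<integral>\<^sup>+x. ennreal (real (n - 1 choose (l - 1)) * real (n - l choose k) *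
       (1 - cdf D x) ^ (l - 1) * (cdf D x - cdf D (x - a)) ^ k * cdf D (x - a) ^ (n - l - k)) \<partial>D)"
  proof -
    have "space D - ({x<..} \<union> {x - a<..x}) = {..x - a}" for x
      using a by (auto simp: spD)
    moreover have "measure D {x<..} = 1 - cdf D x" for x
    proof -
      have "{x<..} = space D - {..x}" by (auto simp: spD)
      thus ?thesis unfolding cdf_def by (simp only: D.prob_compl[of "{..x}"] sD atMost_borel)
    qed
    moreover have "measure D {x - a<..x} = cdf D x - cdf D (x - a)" for x
      using a by (subst RD.cdf_diff_eq) auto
    ultimately show ?thesis using l by (simp add: cdf_def)
  qed
  also have "\<dots> = (\<integral>\<^sup>+x. ennreal (real n) * ennreal (real (n - 1 choose (l - 1)) * real (n - l choose k) *
       (1 - cdf D x) ^ (l - 1) * (cdf D x - cdf D (x - a)) ^ k * cdf D (x - a) ^ (n - l - k)) \<partial>D)"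
    by (subst nn_integral_cmult) (measurable, simp add: ennreal_of_nat_eq_real_of_nat)
  also have "\<dots> = (\<integral>\<^sup>+x. ennreal (real n * real (n - 1 choose (l - 1)) * real (n - l choose k) *
       (1 - cdf D x) ^ (l - 1) * (cdf D x - cdf D (x - a)) ^ k * cdf D (x - a) ^ (n - l - k)) \<partial>D)"
    by (subst ennreal_mult'[symmetric]) (simp_all add: mult_ac)
  finally show ?thesis unfolding 1 .
qed

text \<open>The law of the \<open>(n - l + 1)\<close>-th order statistic of a sample with density \<open>f\<close>, given by its
  well-known density.\<close>

definition order_stat_law :: "(real \<Rightarrow> real) \<Rightarrow> nat \<Rightarrow> nat \<Rightarrow> real measure" where
  "order_stat_law f n l = density lborel (\<lambda>x. ennreal (real n * real ((n - 1) choose (l - 1)) *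
     (1 - density_cdf f x) ^ (l - 1) * density_cdf f x ^ (n - l) * f x))"

text \<open>The conditional probability \<open>1 - F(x - a) / F(x)\<close> that a sample point lies in the window
  \<open>(x - a, x]\<close>, given that it is at most \<open>x\<close>. Where \<open>F(x) = 0\<close>, division by zero makes it \<open>1\<close>,
  which is still a probability, and \<open>order_stat_law\<close> gives these points no mass.\<close>

definition window_prob :: "(real \<Rightarrow> real) \<Rightarrow> real \<Rightarrow> real \<Rightarrow> real" where
  "window_prob f a x = 1 - density_cdf f (x - a) / density_cdf f x"

lemma density_cdf_eq_cdf:
  assumes [measurable]: "f \<in> borel_measurable borel" and f0: "\<And>x. f x \<ge> 0"
  shows "density_cdf f x = cdf (density lborel (\<lambda>x. ennreal (f x))) x"
proof -
  have "density_cdf f x = enn2real (\<integral>\<^sup>+y. ennreal (indicator {..x} y * f y) \<partial>lborel)"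
    unfolding density_cdf_def set_lebesgue_integral_def using f0
    by (subst integral_eq_nn_integral) auto
  also have "\<dots> = cdf (density lborel (\<lambda>x. ennreal (f x))) x"
    unfolding cdf_def measure_def
    by (subst emeasure_density) (auto intro!: arg_cong[where f=enn2real] nn_integral_cong simp: indicator_def)
  finally show ?thesis .
qed

context
  fixes f :: "real \<Rightarrow> real"
  assumes f_borel [measurable]: "f \<in> borel_measurable borel" and f_nonneg: "\<And>x. f x \<ge> 0"
    and f_prob: "prob_space (density lborel (\<lambda>x. ennreal (f x)))"
begin

interpretation RD: real_distribution "density lborel (\<lambda>x. ennreal (f x))"
  using f_prob by (intro real_distribution.intro real_distribution_axioms.intro) auto

lemma density_cdf_bounds: "0 \<le> density_cdf f x" "density_cdf f x \<le> 1"
  and density_cdf_mono: "x \<le> y \<Longrightarrow> density_cdf f x \<le> density_cdf f y"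
  unfolding density_cdf_eq_cdf[OF f_borel f_nonneg]
  by (auto intro: RD.cdf_nonneg RD.cdf_bounded_prob RD.cdf_nondecreasing)

lemma density_cdf_borel [measurable]: "density_cdf f \<in> borel_measurable borel"
  by (intro borel_measurable_mono monoI density_cdf_mono)

lemma window_prob_borel [measurable]: "window_prob f a \<in> borel_measurable borel"
  unfolding window_prob_def[abs_def] by measurable

lemma window_prob_bounds:
  assumes "a > 0"
  shows "0 \<le> window_prob f a x" "window_prob f a x \<le> 1"
  using assms density_cdf_bounds[of x] density_cdf_bounds[of "x - a"] density_cdf_mono[of "x - a" x]
  by (auto simp: window_prob_def divide_le_eq_1)

text \<open>Thus \<open>M\<^sub>j\<close> is the \<open>j\<close>-th moment of the random window probability. The two conventions for
  \<open>F(x) = 0\<close> agree because \<open>l < n\<close> leaves a factor \<open>F(x)\<close> in the density.\<close>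

lemma M_int_eq_integral:
  assumes "l < n"
  shows "M_int f n l a j = (\<integral>x. window_prob f a x ^ j \<partial>order_stat_law f n l)"
proof -
  have "(\<integral>x. window_prob f a x ^ j \<partial>order_stat_law f n l) =
    (LBINT x. real n * real ((n - 1) choose (l - 1)) * (1 - density_cdf f x) ^ (l - 1) *
       density_cdf f x ^ (n - l) * f x * window_prob f a x ^ j)"
    unfolding order_stat_law_def
    by (subst integral_density) (use density_cdf_bounds f_nonneg in \<open>auto intro!: mult_nonneg_nonneg\<close>)
  also have "\<dots> = (LBINT x. (real n * real ((n - 1) choose (l - 1))) *
      (if density_cdf f x = 0 then 0
       else (1 - density_cdf f x) ^ (l - 1) * density_cdf f x ^ (n - l) *
            (1 - density_cdf f (x - a) / density_cdf f x) ^ j * f x))"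
    using assms by (intro Bochner_Integration.integral_cong) (auto simp: window_prob_def power_0_left)
  finally show ?thesis unfolding M_int_def by simp
qed

lemma trinomial_eq_window_binomial:
  assumes "a > 0" "l < n"
  shows "real (n - l choose k) * (density_cdf f x - density_cdf f (x - a)) ^ k * density_cdf f (x - a) ^ (n - l - k)
    = density_cdf f x ^ (n - l) *
      (real (n - l choose k) * window_prob f a x ^ k * (1 - window_prob f a x) ^ (n - l - k))"
proof (cases "k \<le> n - l")
  case k: True
  show ?thesis
  proof (cases "density_cdf f x = 0")
    case True
    hence "density_cdf f (x - a) = 0"
      using density_cdf_bounds[of "x - a"] density_cdf_mono[of "x - a" x] assms by simp
    thus ?thesis using True assms k by (cases "k = 0") (auto simp: power_0_left)
  next
    case False
    have "density_cdf f x ^ (n - l) = density_cdf f x ^ k * density_cdf f x ^ (n - l - k)"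
      unfolding power_add[symmetric] using k by (intro arg_cong[where f="power (density_cdf f x)"]) simp
    moreover have "density_cdf f x - density_cdf f (x - a) = density_cdf f x * window_prob f a x"
      using False by (simp add: window_prob_def field_simps)
    moreover have "density_cdf f (x - a) = density_cdf f x * (1 - window_prob f a x)"
      using False by (simp add: window_prob_def)
    ultimately show ?thesis by (simp add: power_mult_distrib)
  qed
qed (simp add: binomial_eq_0)

end

text \<open>\<open>W = K - 1\<close> is a mixed binomial variable: conditionally on the order statistic being \<open>x\<close>, each
  of the \<open>n - l\<close> smaller sample points lies in the window with probability
  \<open>window_prob f a x\<close>, independently.\<close>

lemma near_order_stat_count_mixed_binomial:
  fixes M :: "'a measure" and X :: "nat \<Rightarrow> 'a \<Rightarrow> real" and f :: "real \<Rightarrow> real"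
  assumes M: "prob_space M" and l: "1 \<le> l" "l < n" and a: "a > 0"
    and indep: "prob_space.indep_vars M (\<lambda>_. borel) X {1..n}"
    and f: "f \<in> borel_measurable borel" "\<And>x. f x \<ge> 0"
    and X: "\<And>i. i \<in> {1..n} \<Longrightarrow> distributed M lborel (X i) (\<lambda>x. ennreal (f x))"
  defines "W \<equiv> \<lambda>\<omega>. near_order_stat_count X n a l \<omega> - 1"
  shows "prob_space (order_stat_law f n l)"
    and "(\<integral>\<omega>. h (W \<omega>) \<partial>M) =
      (\<integral>x. binom_mean (n - l) (window_prob f a x) h \<partial>order_stat_law f n l)"
proof -
  interpret M: prob_space M by fact
  note [measurable] = f(1)
  define D where "D = density lborel (\<lambda>x. ennreal (f x))"
  have D: "distr M borel (X i) = D" if "i \<in> {1..n}" for i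
  proof -
    have "distr M borel (X i) = distr M lborel (X i)" by (intro distr_cong) auto
    thus ?thesis using distributed_distr_eq_density[OF X[OF that]] by (simp add: D_def)
  qed
  have pD: "prob_space D"
    unfolding D[of 1, symmetric] using l distributed_measurable[OF X[of 1]]
    by (auto intro!: M.prob_space_distr simp: D[of 1, symmetric])
  note cx = f pD[unfolded D_def]
  note [measurable] = density_cdf_borel[OF cx] window_prob_borel[OF cx]
  note wp = window_prob_bounds[OF cx a]
  have atomless: "measure D {x} = 0" for x
  proof -
    have "emeasure D {x} = 0"
      unfolding D_def by (subst emeasure_density) (auto simp: nn_integral_0_iff_AE AE_lborel_singleton
          intro!: eventually_mono[OF AE_lborel_singleton[of x]])
    thus ?thesis by (simp add: measure_def)
  qed
  define Q where "Q = order_stat_law f n l"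
  have sQ [measurable_cong]: "sets Q = sets borel" by (simp add: Q_def order_stat_law_def)
  define w where "w k x = real (n - l choose k) * window_prob f a x ^ k * (1 - window_prob f a x) ^ (n - l - k)" for k x
  have w_borel [measurable]: "w k \<in> borel_measurable borel" for k unfolding w_def by measurable
  have w0: "0 \<le> w k x" for k x unfolding w_def using wp[of x] by simp
  have w_zero: "w k x = 0" if "k > n - l" for k x using that by (simp add: w_def binomial_eq_0)
  have binom_w: "binom_mean (n - l) (window_prob f a x) h = (\<Sum>k\<le>n. w k x * h k)" for x and h :: "nat \<Rightarrow> real"
    unfolding binom_mean_def w_def[symmetric]
    by (intro sum.mono_neutral_left) (auto simp: w_zero)
  have "W \<in> measurable M (count_space UNIV)"
  proof -
    have [measurable]: "near_order_stat_count X n a l \<in> measurable M (count_space UNIV)"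
      using l distributed_measurable[OF X] by (intro near_order_stat_count_measurable) auto
    show ?thesis unfolding W_def by measurable
  qed
  note [measurable] = this
  have W_le: "W \<omega> \<le> n" for \<omega>
    using near_order_stat_count_bounds(2)[of l n a X \<omega>] l a by (simp add: W_def)
  have law: "emeasure M {\<omega> \<in> space M. W \<omega> = k} = (\<integral>\<^sup>+x. ennreal (w k x) \<partial>Q)" for k
  proof -
    have "emeasure M {\<omega> \<in> space M. W \<omega> = k} =
      (\<integral>\<^sup>+x. ennreal (real n * real (n - 1 choose (l - 1)) * real (n - l choose k) *
         (1 - density_cdf f x) ^ (l - 1) * (density_cdf f x - density_cdf f (x - a)) ^ k *
         density_cdf f (x - a) ^ (n - l - k)) \<partial>D)"
      unfolding W_def density_cdf_eq_cdf[OF f] D_def[symmetric]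
      using l a by (intro emeasure_near_order_stat_count M indep D atomless) auto
    also have "\<dots> = (\<integral>\<^sup>+x. ennreal (real n * real (n - 1 choose (l - 1)) *
         (1 - density_cdf f x) ^ (l - 1) * density_cdf f x ^ (n - l) * w k x) \<partial>D)"
    proof (intro nn_integral_cong arg_cong[where f=ennreal])
      fix x
      show "real n * real (n - 1 choose (l - 1)) * real (n - l choose k) *
         (1 - density_cdf f x) ^ (l - 1) * (density_cdf f x - density_cdf f (x - a)) ^ k *
         density_cdf f (x - a) ^ (n - l - k) =
         real n * real (n - 1 choose (l - 1)) *
         (1 - density_cdf f x) ^ (l - 1) * density_cdf f x ^ (n - l) * w k x"
        using trinomial_eq_window_binomial[OF cx a l(2), of k x] unfolding w_def[symmetric]
        by (simp add: mult_ac)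
    qed
    also have "\<dots> = (\<integral>\<^sup>+x. ennreal (w k x) \<partial>Q)"
      unfolding Q_def order_stat_law_def D_def
      by (subst (1 2) nn_integral_density)
         (use density_cdf_bounds[OF cx] f w0 in
           \<open>auto intro!: nn_integral_cong mult_nonneg_nonneg simp: ennreal_mult[symmetric] mult_ac\<close>)
    finally show ?thesis .
  qed
  \<comment> \<open>The total mass of the mixing measure is read off from the total mass of the law of \<open>W\<close>, so
      no beta integral has to be evaluated.\<close>
  have pQ: "prob_space Q"
  proof
    have "emeasure Q (space Q) = (\<integral>\<^sup>+x. 1 \<partial>Q)" by simp
    also have "\<dots> = (\<integral>\<^sup>+x. (\<Sum>k\<le>n. ennreal (w k x)) \<partial>Q)"
    proof (intro nn_integral_cong)
      fix x
      have "(\<Sum>k\<le>n. w k x) = 1" using binom_w[of x "\<lambda>_. 1"] by simp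
      thus "1 = (\<Sum>k\<le>n. ennreal (w k x))" using w0 by (simp add: sum_ennreal)
    qed
    also have "\<dots> = (\<Sum>k\<le>n. \<integral>\<^sup>+x. ennreal (w k x) \<partial>Q)"
      by (rule nn_integral_sum) measurable
    also have "\<dots> = (\<Sum>k\<le>n. emeasure M {\<omega> \<in> space M. W \<omega> = k})" by (simp add: law)
    also have "\<dots> = emeasure M (\<Union>k\<le>n. {\<omega> \<in> space M. W \<omega> = k})"
      by (rule sum_emeasure) (auto simp: disjoint_family_on_def)
    also have "(\<Union>k\<le>n. {\<omega> \<in> space M. W \<omega> = k}) = space M" using W_le by auto
    finally show "emeasure Q (space Q) = 1" by (simp add: M.emeasure_space_1)
  qed
  thus "prob_space (order_stat_law f n l)" by (simp add: Q_def)
  interpret Q: prob_space Q by fact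
  have w_le: "w k x \<le> 1" for k x
  proof (cases "k \<le> n")
    case True
    have "w k x \<le> (\<Sum>k\<le>n. w k x)" using True w0 by (intro member_le_sum) auto
    thus ?thesis using binom_w[of x "\<lambda>_. 1"] by simp
  qed (use w_zero in simp)
  have iw: "integrable Q (w k)" for k
    using w0 w_le by (intro Q.integrable_const_bound[where B=1]) auto
  have lawr: "measure M {\<omega> \<in> space M. W \<omega> = k} = (\<integral>x. w k x \<partial>Q)" for k
    unfolding measure_def law using w0 by (subst integral_eq_nn_integral) auto
  have "(\<integral>\<omega>. h (W \<omega>) \<partial>M) = (\<integral>\<omega>. (\<Sum>k\<le>n. h k * indicator {\<omega> \<in> space M. W \<omega> = k} \<omega>) \<partial>M)"
  proof (intro Bochner_Integration.integral_cong refl)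
    fix \<omega> assume \<omega>: "\<omega> \<in> space M"
    have "(\<Sum>k\<le>n. h k * indicator {\<omega> \<in> space M. W \<omega> = k} \<omega>) = (\<Sum>k\<le>n. if k = W \<omega> then h k else 0)"
      using \<omega> by (intro sum.cong) (auto simp: indicator_def)
    thus "h (W \<omega>) = (\<Sum>k\<le>n. h k * indicator {\<omega> \<in> space M. W \<omega> = k} \<omega>)"
      using W_le[of \<omega>] by simp
  qed
  also have "\<dots> = (\<Sum>k\<le>n. h k * measure M {\<omega> \<in> space M. W \<omega> = k})"
    by (subst Bochner_Integration.integral_sum) (auto simp: M.emeasure_eq_measure)
  also have "\<dots> = (\<integral>x. (\<Sum>k\<le>n. w k x * h k) \<partial>Q)"
    using iw by (simp add: lawr mult.commute)
  finally show "(\<integral>\<omega>. h (W \<omega>) \<partial>M) = (\<integral>x. binom_mean (n - l) (window_prob f a x) h \<partial>order_stat_law f n l)"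
    unfolding binom_w Q_def .
qed

section \<open>The approximation theorem\<close>

theorem theorem5:
  fixes M :: "'a measure" and N :: "'b measure"
    and X :: "nat \<Rightarrow> 'a \<Rightarrow> real" and Z :: "'b \<Rightarrow> nat"
    and f :: "real \<Rightarrow> real" and n l :: nat and a \<beta> M\<^sub>1 M\<^sub>2 :: real
    and K :: "'a \<Rightarrow> nat"
  assumes "n \<ge> 2" and "l \<in> {1..n - 1}" and "a > 0"
    and "prob_space M"
    and "prob_space.indep_vars M (\<lambda>_. borel) X {1..n}"
    and "f \<in> borel_measurable borel" and "\<And>x. f x \<ge> 0"
    and "\<And>i. i \<in> {1..n} \<Longrightarrow> distributed M lborel (X i) (\<lambda>x. ennreal (f x))"
  defines "K \<equiv> near_order_stat_count X n a l"
    and "M\<^sub>1 \<equiv> M_int f n l a 1"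
    and "M\<^sub>2 \<equiv> M_int f n l a 2"
  assumes "\<beta> = ((\<integral>\<omega>. real (K \<omega>) \<partial>M) - 1) / ((\<integral>\<omega>. real (K \<omega>) \<partial>M) + real l - 1)"
    and "prob_space N"
    and "neg_binomial_rv N Z (real l) (1 - \<beta>)"
  shows "tv_dist M (\<lambda>\<omega>. K \<omega> - 1) N Z
       \<le> (1 - (1 - \<beta>) ^ l) / (\<beta> * real l) * (\<integral>\<omega>. (real (K \<omega>) - 1) \<partial>M) *
         (\<beta> + (1 - \<beta>) * ((real n - real l - 1) * (M\<^sub>2 / M\<^sub>1) - (real n - real l - 2) * M\<^sub>1))"
proof -
  interpret M: prob_space M by fact
  interpret N: prob_space N by fact
  have l: "1 \<le> l" "l < n" using assms(1,2) by auto
  have Nl: "real (n - l) = real n - real l" using l by (simp add: of_nat_diff)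
  define W where "W \<omega> = K \<omega> - 1" for \<omega>
  define \<mu> where "\<mu> = (\<integral>\<omega>. real (W \<omega>) \<partial>M)"
  have K: "1 \<le> K \<omega>" "K \<omega> \<le> n" for \<omega>
    using near_order_stat_count_bounds[of l n a X \<omega>] l assms(3) by (auto simp: K_def)
  have K_meas [measurable]: "K \<in> measurable M (count_space UNIV)"
    unfolding K_def using l distributed_measurable[OF assms(8)]
    by (intro near_order_stat_count_measurable) auto
  have W_meas [measurable]: "W \<in> measurable M (count_space UNIV)" unfolding W_def by measurable
  have Wr: "real (W \<omega>) = real (K \<omega>) - 1" for \<omega>
    using K[of \<omega>] by (simp add: W_def of_nat_diff)
  have bdd: "integrable M (\<lambda>\<omega>. h (K \<omega>))" for h :: "nat \<Rightarrow> real"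
  proof (rule M.integrable_const_bound[where B="\<Sum>k\<le>n. \<bar>h k\<bar>"])
    show "AE \<omega> in M. norm (h (K \<omega>)) \<le> (\<Sum>k\<le>n. \<bar>h k\<bar>)"
      using K by (intro AE_I2) (auto intro!: member_le_sum)
  qed measurable
  have EK: "(\<integral>\<omega>. (real (K \<omega>) - 1) \<partial>M) = \<mu>" by (simp add: \<mu>_def Wr)
  have EK': "(\<integral>\<omega>. real (K \<omega>) \<partial>M) = \<mu> + 1"
    using EK bdd[of real] M.prob_space by simp
  have \<beta>: "\<beta> = \<mu> / (\<mu> + real l)" using assms(12) unfolding EK' by simp
  have \<mu>0: "0 \<le> \<mu>" unfolding \<mu>_def by simp
  have mixed: "prob_space (order_stat_law f n l)"
    "(\<integral>\<omega>. h (W \<omega>) \<partial>M) = (\<integral>x. binom_mean (n - l) (window_prob f a x) h \<partial>order_stat_law f n l)"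
    for h
    unfolding W_def K_def
    using near_order_stat_count_mixed_binomial[OF assms(4) l assms(3) assms(5-8)] by auto
  interpret Q: prob_space "order_stat_law f n l" by (rule mixed)
  have "prob_space (density lborel (\<lambda>x. ennreal (f x)))"
    using l distributed_distr_eq_density[OF assms(8)[of 1]] M.prob_space_distr[OF distributed_measurable[OF assms(8)[of 1]]]
    by simp
  note cx = assms(6,7) this
  note [measurable] = window_prob_borel[OF cx]
  have sQ [measurable_cong]: "sets (order_stat_law f n l) = sets borel" by (simp add: order_stat_law_def)
  have M1: "M\<^sub>1 = (\<integral>x. window_prob f a x \<partial>order_stat_law f n l)"
    and M2: "M\<^sub>2 = (\<integral>x. (window_prob f a x)\<^sup>2 \<partial>order_stat_law f n l)"
    unfolding M\<^sub>1_def M\<^sub>2_def M_int_eq_integral[OF cx l(2)] by simp_all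
  have \<mu>M: "\<mu> = real (n - l) * M\<^sub>1"
  proof -
    obtain m where m: "n - l = Suc m" using l by (cases "n - l") auto
    have "\<mu> = (\<integral>x. binom_mean (n - l) (window_prob f a x) (\<lambda>k. real k * 1) \<partial>order_stat_law f n l)"
      using mixed(2)[of real] by (simp add: \<mu>_def)
    also have "\<dots> = real (n - l) * M\<^sub>1"
      unfolding m binom_mean_size_bias M1 by simp
    finally show ?thesis .
  qed
  have tv: "tv_dist M (\<lambda>\<omega>. K \<omega> - 1) N Z \<le> B"
    if "\<And>E. \<bar>measure M {\<omega> \<in> space M. W \<omega> \<in> E} - measure N {\<omega> \<in> space N. Z \<omega> \<in> E}\<bar> \<le> B" for B
    unfolding tv_dist_def W_def[symmetric] using that by (intro cSUP_least) auto
  show ?thesis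
  proof (cases "\<mu> = 0")
    case True
    \<comment> \<open>The degenerate case \<open>\<beta> = 0\<close>: both variables vanish almost surely, and the right-hand side,
        although it contains a division by zero, is \<open>0\<close> because of the factor \<open>\<mu>\<close>.\<close>
    have \<beta>0: "\<beta> = 0" using True \<beta> by simp
    have Z_meas [measurable]: "Z \<in> measurable N (count_space UNIV)"
      using assms(14) by (simp add: neg_binomial_rv_def)
    have "integrable M (\<lambda>\<omega>. real (W \<omega>))" using bdd[of "\<lambda>k. real k - 1"] by (simp add: Wr)
    hence W0: "AE \<omega> in M. W \<omega> = 0"
      using integral_nonneg_eq_0_iff_AE[of M "\<lambda>\<omega>. real (W \<omega>)"] True by (simp add: \<mu>_def)
    have "measure N {\<omega> \<in> space N. Z \<omega> = 0} = 1"
      using assms(14) Gamma_real_pos[of "real l"] l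
      by (simp add: neg_binomial_rv_def \<beta>0 less_imp_neq[symmetric])
    hence "AE \<omega> in N. \<omega> \<in> {\<omega> \<in> space N. Z \<omega> = 0}" by (subst N.AE_in_set_eq_1) auto
    hence Z0: "AE \<omega> in N. Z \<omega> = 0" by eventually_elim simp
    have "measure M {\<omega> \<in> space M. W \<omega> \<in> E} = indicator E 0" for E
    proof -
      have "measure M {\<omega> \<in> space M. W \<omega> \<in> E} = measure M (if 0 \<in> E then space M else {})"
        by (rule M.finite_measure_eq_AE) (use W0 in \<open>auto elim!: eventually_mono\<close>)
      thus ?thesis using M.prob_space by (simp add: indicator_def)
    qed
    moreover have "measure N {\<omega> \<in> space N. Z \<omega> \<in> E} = indicator E 0" for E
    proof -
      have "measure N {\<omega> \<in> space N. Z \<omega> \<in> E} = measure N (if 0 \<in> E then space N else {})"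
        by (rule N.finite_measure_eq_AE) (use Z0 in \<open>auto elim!: eventually_mono\<close>)
      thus ?thesis using N.prob_space by (simp add: indicator_def)
    qed
    ultimately have "tv_dist M (\<lambda>\<omega>. K \<omega> - 1) N Z \<le> 0" by (intro tv) simp
    thus ?thesis unfolding EK True by simp
  next
    case False
    hence \<mu>p: "\<mu> > 0" using \<mu>0 by simp
    have \<beta>01: "0 < \<beta>" "\<beta> < 1" unfolding \<beta> using \<mu>p l by (auto simp: field_simps)
    have mean: "\<beta> * real l = (1 - \<beta>) * (real (n - l) * M\<^sub>1)"
      unfolding \<mu>M[symmetric] \<beta> using \<mu>p l by (simp add: field_simps)
    have M1p: "0 < M\<^sub>1" using \<mu>p \<mu>M l by (simp add: zero_less_mult_iff)
    let ?\<pi> = "\<lambda>k. measure N {\<omega> \<in> space N. Z \<omega> = k}"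
    have lr: "0 < real l" using l by simp
    note nb = neg_binomial_rv_pmf[OF assms(13,14) lr]
    have p01: "0 < 1 - \<beta>" "1 - \<beta> < 1" using \<beta>01 by auto
    have \<pi>pos: "?\<pi> k > 0" and rec: "real (Suc k) * ?\<pi> (Suc k) = \<beta> * (real l + real k) * ?\<pi> k" for k
      using nb(1,2)[OF p01, of k] by simp_all
    have \<pi>0: "?\<pi> 0 = (1 - \<beta>) ^ l"
      using nb(3)[OF p01] \<beta>01 by (simp add: powr_realpow)
    have \<pi>E: "(\<lambda>k. indicator E k * ?\<pi> k) sums measure N {\<omega> \<in> space N. Z \<omega> \<in> E}" for E
      by (rule nb(4)[OF p01])
    have \<pi>1: "?\<pi> sums 1" using \<pi>E[of UNIV] by (simp add: N.prob_space)
    show ?thesis unfolding EK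
    proof (rule tv)
      fix E :: "nat set"
      obtain g where g: "\<And>k. \<beta> * (real l + real k) * g (Suc k) - real k * g k
            = indicator E k - (\<Sum>j. indicator E j * ?\<pi> j)"
        and dg: "\<And>k. k \<ge> 1 \<Longrightarrow> \<bar>g (Suc k) - g k\<bar> \<le> (1 - ?\<pi> 0) / (\<beta> * real l)"
      proof (rule neg_binomial_stein_solution[where E=E, OF \<beta>01 lr \<pi>pos \<pi>1 rec])
        fix g assume "\<And>k. \<beta> * (real l + real k) * g (Suc k) - real k * g k
            = indicator E k - (\<Sum>j. indicator E j * ?\<pi> j)"
          and "\<And>k. k \<ge> 1 \<Longrightarrow> \<bar>g (Suc k) - g k\<bar> \<le> (1 - ?\<pi> 0) / (\<beta> * real l)"
        thus thesis by (rule that)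
      qed
      have gE: "\<beta> * (real l + real k) * g (Suc k) - real k * g k
            = indicator E k - measure N {\<omega> \<in> space N. Z \<omega> \<in> E}" for k
        unfolding g using \<pi>E[of E] by (simp add: sums_iff)
      have "measure M {\<omega> \<in> space M. W \<omega> \<in> E} - measure N {\<omega> \<in> space N. Z \<omega> \<in> E} =
          (\<integral>\<omega>. indicator E (W \<omega>) - measure N {\<omega> \<in> space N. Z \<omega> \<in> E} \<partial>M)"
      proof -
        have "(\<integral>\<omega>. indicator E (W \<omega>) \<partial>M) = (\<integral>\<omega>. indicator {\<omega> \<in> space M. W \<omega> \<in> E} \<omega> \<partial>M)"
          by (intro Bochner_Integration.integral_cong) (auto simp: indicator_def)
        also have "\<dots> = measure M {\<omega> \<in> space M. W \<omega> \<in> E}" by simp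
        finally show ?thesis
          using bdd[of "\<lambda>k. indicator E (k - 1)"] M.prob_space by (simp add: W_def)
      qed
      also have "\<dots> = (\<integral>x. binom_mean (n - l) (window_prob f a x)
          (\<lambda>k. \<beta> * (real l + real k) * g (Suc k) - real k * g k) \<partial>order_stat_law f n l)"
        unfolding mixed(2)[symmetric] gE ..
      also have "\<bar>\<dots>\<bar> \<le> (1 - ?\<pi> 0) / (\<beta> * real l) * (real (n - l) * M\<^sub>1) *
          (\<beta> + (1 - \<beta>) * ((real (n - l) - 1) * (M\<^sub>2 / M\<^sub>1) - (real (n - l) - 2) * M\<^sub>1))"
        unfolding M1 M2
        using l \<beta>01 M1p mean dg window_prob_bounds[OF cx assms(3)]
        by (intro Q.mixed_binomial_stein_bound) (auto simp: M1[symmetric])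
      finally show "\<bar>measure M {\<omega> \<in> space M. W \<omega> \<in> E} - measure N {\<omega> \<in> space N. Z \<omega> \<in> E}\<bar>
        \<le> (1 - (1 - \<beta>) ^ l) / (\<beta> * real l) * \<mu> *
          (\<beta> + (1 - \<beta>) * ((real n - real l - 1) * (M\<^sub>2 / M\<^sub>1) - (real n - real l - 2) * M\<^sub>1))"
        unfolding \<pi>0 \<mu>M Nl .
    qed
  qed
qed

end
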